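(* Let $A, B \in M_n(\mathbb{C})$ be such that $e^{kA+lB} = e^{kA}e^{lB}$ for all $(k,l) \in \mathbb{Z}^2$. Then $AB = BA$.
   Context: $e^M = \exp(M)$ denotes the matrix exponential of $M \in M_n(\mathbb{C})$. *)

theory Defs
  imports "HOL-Analysis.Analysis"
begin

primrec matrix_power :: "'a::comm_ring_1^'n^'n \<Rightarrow> nat \<Rightarrow> 'a^'n^'n" where
  "matrix_power A 0 = mat 1"
| "matrix_power A (Suc k) = A ** matrix_power A k"

definition matrix_exp :: "complex^'n^'n \<Rightarrow> complex^'n^'n" where
  "matrix_exp A = (\<Sum>k. (1 / fact k) *\<^sub>R matrix_power A k)"

end

theory Submission
  imports Defs "HOL-Computational_Algebra.Fundamental_Theorem_Algebra"
begin

text \<open>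
  The hypothesis makes \<open>U = exp A\<close> and \<open>V = exp B\<close> commute, and since \<open>k A + l B\<close> commutes with
  \<open>U\<^sup>k V\<^sup>l\<close>, the conjugation defects \<open>V A V\<^sup>-\<^sup>1 - A\<close> and \<open>U B U\<^sup>-\<^sup>1 - B\<close> are opposite to each other and
  commute with \<open>V\<close> and \<open>U\<close> respectively. Choose logarithms \<open>X\<close> of \<open>U\<close> and \<open>Y\<close> of \<open>V\<close> in the double
  commutants of \<open>U\<close> and \<open>V\<close>. Then \<open>[Y, A]\<close> and \<open>[X, B]\<close> are exactly these defects, so \<open>k X + l Y\<close>
  commutes with \<open>k A + l B\<close>, and \<open>S = A - X\<close>, \<open>T = B - Y\<close> satisfy \<open>exp (k S + l T) = 1\<close> for all
  integers \<open>k\<close> and \<open>l\<close>.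

  In that situation a Bauer--Fike bound confines the eigenvalues of \<open>k S + T\<close>, which lie in
  \<open>2 \<pi> i \<int>\<close>, to the values at \<open>k\<close> of finitely many affine functions, so the pencil \<open>z S + T\<close> has
  affine eigenvalues. These cross only at rational points, where the pencil is semisimple; first
  order perturbation theory there and at infinity shows that the eigenprojections are constant,
  hence \<open>S\<close> and \<open>T\<close> commute (Motzkin--Taussky).

  Finally \<open>[S, Y] = [X, T]\<close> commutes with \<open>S\<close>, and conjugating \<open>Y\<close> by \<open>exp S = 1\<close> gives
  \<open>[S, Y] = 0\<close>. So \<open>S\<close>, \<open>T\<close>, \<open>X\<close>, \<open>Y\<close> commute pairwise.
\<close>

section \<open>Complex matrices as a Banach algebra\<close>

text \<open>A separate type lets \<open>*\<close> be the matrix product and the norm be the operator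
  norm. The norm of arrays of entries gives the identity the square root of the dimension, whereas a
  normed algebra with unit asks for 1.\<close>

typedef 'n cmat = "UNIV :: (complex^'n^'n) set" morphisms mat_of cmat_of ..

setup_lifting type_definition_cmat

lemma norm_vec_le_sum:
  fixes x :: "'a::real_normed_vector^'n"
  shows "norm x \<le> (\<Sum>i\<in>UNIV. norm (x $ i))"
  by (simp add: norm_vec_def L2_set_le_sum)

lemma matrix_vector_mult_axis_one:
  fixes A :: "complex^'n^'m"
  shows "(A *v axis j 1) $ i = A $ i $ j"
  by (simp add: matrix_vector_mult_def axis_def if_distrib[of "\<lambda>x. _ * x"] cong: if_cong)

lemma norm_entry_le_onorm:
  fixes A :: "complex^'n^'m"
  shows "norm (A $ i $ j) \<le> onorm ((*v) A)"
proof -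
  have "norm (A $ i $ j) \<le> norm (A *v axis j 1)"
    by (metis Finite_Cartesian_Product.norm_nth_le matrix_vector_mult_axis_one)
  also have "\<dots> \<le> onorm ((*v) A) * norm (axis j (1::complex))"
    by (rule onorm) simp
  finally show ?thesis by simp
qed

lemma onorm_le_sum_norm_entries:
  fixes A :: "complex^'n^'m"
  shows "onorm ((*v) A) \<le> (\<Sum>i\<in>UNIV. \<Sum>j\<in>UNIV. norm (A $ i $ j))"
proof (rule onorm_le)
  fix x
  have "norm (A *v x) \<le> (\<Sum>i\<in>UNIV. norm ((A *v x) $ i))" by (rule norm_vec_le_sum)
  also have "\<dots> \<le> (\<Sum>i\<in>UNIV. \<Sum>j\<in>UNIV. norm (A $ i $ j) * norm x)"
  proof (rule sum_mono)
    fix i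
    have "norm ((A *v x) $ i) \<le> (\<Sum>j\<in>UNIV. norm (A $ i $ j * x $ j))"
      unfolding matrix_vector_mult_def by (simp add: norm_sum)
    also have "\<dots> \<le> (\<Sum>j\<in>UNIV. norm (A $ i $ j) * norm x)"
      by (intro sum_mono) (simp add: norm_mult mult_left_mono Finite_Cartesian_Product.norm_nth_le)
    finally show "norm ((A *v x) $ i) \<le> (\<Sum>j\<in>UNIV. norm (A $ i $ j) * norm x)" .
  qed
  finally show "norm (A *v x) \<le> (\<Sum>i\<in>UNIV. \<Sum>j\<in>UNIV. norm (A $ i $ j)) * norm x"
    by (simp add: sum_distrib_right)
qed

instantiation cmat :: (finite) real_algebra_1
begin
lift_definition zero_cmat :: "'a cmat" is 0 .
lift_definition one_cmat :: "'a cmat" is "mat 1" .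
lift_definition plus_cmat :: "'a cmat \<Rightarrow> 'a cmat \<Rightarrow> 'a cmat" is "(+)" .
lift_definition minus_cmat :: "'a cmat \<Rightarrow> 'a cmat \<Rightarrow> 'a cmat" is "(-)" .
lift_definition uminus_cmat :: "'a cmat \<Rightarrow> 'a cmat" is "uminus" .
lift_definition times_cmat :: "'a cmat \<Rightarrow> 'a cmat \<Rightarrow> 'a cmat" is "(**)" .
lift_definition scaleR_cmat :: "real \<Rightarrow> 'a cmat \<Rightarrow> 'a cmat" is "(*\<^sub>R)" .
instance
proof
  fix a b c :: "'a cmat" and r q :: real
  show "a + b + c = a + (b + c)" "a + b = b + a" "0 + a = a" "- a + a = 0" "a - b = a + - b"
    "r *\<^sub>R (a + b) = r *\<^sub>R a + r *\<^sub>R b" "(r + q) *\<^sub>R a = r *\<^sub>R a + q *\<^sub>R a"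
    "r *\<^sub>R q *\<^sub>R a = (r * q) *\<^sub>R a" "1 *\<^sub>R a = a"
    by (transfer; simp add: algebra_simps)+
  show "a * b * c = a * (b * c)" by transfer (simp add: matrix_mul_assoc)
  show "1 * a = a" "a * 1 = a" by (transfer; simp)+
  show "(a + b) * c = a * c + b * c" "a * (b + c) = a * b + a * c"
    by (transfer; simp add: matrix_matrix_mult_def vec_eq_iff algebra_simps sum.distrib)+
  show "r *\<^sub>R a * b = r *\<^sub>R (a * b)" "a * r *\<^sub>R b = r *\<^sub>R (a * b)"
    by (transfer; simp add: matrix_matrix_mult_def vec_eq_iff scaleR_sum_right)+
  show "0 \<noteq> (1::'a cmat)" by transfer (simp add: mat_def vec_eq_iff)
qed
end

instantiation cmat :: (finite) real_normed_algebra_1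
begin
lift_definition norm_cmat :: "'a cmat \<Rightarrow> real" is "\<lambda>A. onorm ((*v) A)" .
definition dist_cmat :: "'a cmat \<Rightarrow> 'a cmat \<Rightarrow> real" where "dist_cmat x y = norm (x - y)"
definition sgn_cmat :: "'a cmat \<Rightarrow> 'a cmat" where "sgn_cmat x = x /\<^sub>R norm x"
definition uniformity_cmat :: "('a cmat \<times> 'a cmat) filter"
  where "uniformity_cmat = (INF e\<in>{0<..}. principal {(x, y). dist x y < e})"
definition open_cmat :: "'a cmat set \<Rightarrow> bool"
  where "open_cmat U = (\<forall>x\<in>U. \<forall>\<^sub>F (x', y) in uniformity. x' = x \<longrightarrow> y \<in> U)"
instance
proof
  fix x y :: "'a cmat" and a :: real
  show "(norm x = 0) = (x = 0)"
  proof transfer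
    fix x :: "complex^'a^'a"
    have "norm (x $ i $ j) \<le> 0" if "onorm ((*v) x) = 0" for i j
      using norm_entry_le_onorm[of x i j] that by simp
    moreover have "onorm ((*v) (0::complex^'a^'a)) = 0"
      by (intro onorm_eq_0[THEN iffD2]) auto
    ultimately show "(onorm ((*v) x) = 0) = (x = 0)" by (metis norm_le_zero_iff vec_eq_iff zero_index)
  qed
  show "norm (x + y) \<le> norm x + norm y"
    by transfer (metis (no_types, lifting) ext matrix_vector_mul_bounded_linear matrix_vector_mult_add_rdistrib onorm_triangle)
  show "norm (a *\<^sub>R x) = \<bar>a\<bar> * norm x"
  proof transfer
    fix a and x :: "complex^'a^'a"
    have "(*v) (a *\<^sub>R x) = (\<lambda>v. a *\<^sub>R (x *v v))"
      by (auto simp: matrix_vector_mult_def vec_eq_iff scaleR_sum_right)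
    then show "onorm ((*v) (a *\<^sub>R x)) = \<bar>a\<bar> * onorm ((*v) x)"
      by (simp add: onorm_scaleR)
  qed
  show "norm (x * y) \<le> norm x * norm y"
  proof transfer
    fix x y :: "complex^'a^'a"
    have "(*v) (x ** y) = (*v) x \<circ> (*v) y" by (auto simp: matrix_vector_mul_assoc)
    then show "onorm ((*v) (x ** y)) \<le> onorm ((*v) x) * onorm ((*v) y)"
      by (simp add: onorm_compose)
  qed
  show "norm (1::'a cmat) = 1"
  proof transfer
    have "(*v) (mat 1 :: complex^'a^'a) = (\<lambda>x. x)" by auto
    moreover have "onorm (\<lambda>x::complex^'a. x) = 1"
    proof (rule onorm_id)
    qed
    ultimately show "onorm ((*v) (mat 1 :: complex^'a^'a)) = 1" by simp
  qed
qed (simp_all add: dist_cmat_def sgn_cmat_def uniformity_cmat_def open_cmat_def)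
end

lemma bounded_linear_mat_of: "bounded_linear (mat_of :: 'n::finite cmat \<Rightarrow> _)"
proof
  show "\<exists>K. \<forall>x::'n cmat. norm (mat_of x) \<le> norm x * K"
  proof (intro exI allI)
    fix x :: "'n cmat"
    have "norm (mat_of x) \<le> (\<Sum>i\<in>UNIV. \<Sum>j\<in>UNIV. norm (mat_of x $ i $ j))"
      by (rule order_trans[OF norm_vec_le_sum]) (intro sum_mono norm_vec_le_sum)
    also have "\<dots> \<le> (\<Sum>(i::'n)\<in>UNIV. \<Sum>(j::'n)\<in>UNIV. norm x)"
      by (intro sum_mono) (simp add: norm_cmat.rep_eq norm_entry_le_onorm)
    finally show "norm (mat_of x) \<le> norm x * (real CARD('n) * real CARD('n))" by (simp add: mult_ac)
  qed
qed (simp_all add: plus_cmat.rep_eq scaleR_cmat.rep_eq)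

lemma bounded_linear_cmat_of: "bounded_linear (cmat_of :: _ \<Rightarrow> 'n::finite cmat)"
proof
  show "\<exists>K. \<forall>x. norm (cmat_of x :: 'n cmat) \<le> norm x * K"
  proof (intro exI allI)
    fix x :: "complex^'n^'n"
    have "norm (cmat_of x) \<le> (\<Sum>i\<in>UNIV. \<Sum>j\<in>UNIV. norm (x $ i $ j))"
      by (simp add: norm_cmat.abs_eq onorm_le_sum_norm_entries)
    also have "\<dots> \<le> (\<Sum>(i::'n)\<in>UNIV. \<Sum>(j::'n)\<in>UNIV. norm x)"
      by (intro sum_mono) (meson Finite_Cartesian_Product.norm_nth_le order_trans)
    finally show "norm (cmat_of x) \<le> norm x * (real CARD('n) * real CARD('n))" by (simp add: mult_ac)
  qed
qed (simp_all add: plus_cmat.abs_eq scaleR_cmat.abs_eq)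

instance cmat :: (finite) banach
proof
  fix X :: "nat \<Rightarrow> 'a cmat" assume "Cauchy X"
  then have "Cauchy (\<lambda>n. mat_of (X n))"
    by (rule bounded_linear.Cauchy[OF bounded_linear_mat_of])
  then obtain L where "(\<lambda>n. mat_of (X n)) \<longlonglongrightarrow> L"
    using Cauchy_convergent_iff convergent_def by blast
  then have "(\<lambda>n. cmat_of (mat_of (X n))) \<longlonglongrightarrow> cmat_of L"
    by (rule bounded_linear.tendsto[OF bounded_linear_cmat_of])
  then show "convergent X" by (auto simp: mat_of_inverse convergent_def)
qed

lemma mat_of_power: "mat_of (X ^ k) = matrix_power (mat_of X) k"
  by (induction k) (simp_all add: one_cmat.rep_eq times_cmat.rep_eq)

lemma mat_of_exp: "mat_of (exp X) = matrix_exp (mat_of X)"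
proof -
  have "(\<lambda>k. mat_of (X ^ k /\<^sub>R fact k)) sums mat_of (exp X)"
    by (rule bounded_linear.sums[OF bounded_linear_mat_of exp_converges])
  then show ?thesis
    unfolding matrix_exp_def
    by (simp add: scaleR_cmat.rep_eq mat_of_power sums_iff inverse_eq_divide)
qed

text \<open>The algebra has real scalars only; complex ones enter as multiplication by central
  scalar matrices.\<close>

lift_definition cs :: "complex \<Rightarrow> 'n::finite cmat" is "\<lambda>c. mat c" .

lemma mat_mult_entry:
  fixes X :: "complex^'n^'n"
  shows "(mat c ** X) $ i $ j = c * X $ i $ j" "(X ** mat c) $ i $ j = c * X $ i $ j"
proof -
  have "(mat c ** X) $ i $ j = (\<Sum>k\<in>UNIV. if i = k then c * X $ k $ j else 0)"
    unfolding matrix_matrix_mult_def vec_lambda_beta by (rule sum.cong) (auto simp: mat_def)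
  then show "(mat c ** X) $ i $ j = c * X $ i $ j" by simp
  have "(X ** mat c) $ i $ j = (\<Sum>k\<in>UNIV. if k = j then c * X $ i $ k else 0)"
    unfolding matrix_matrix_mult_def vec_lambda_beta by (rule sum.cong) (auto simp: mat_def)
  then show "(X ** mat c) $ i $ j = c * X $ i $ j" by simp
qed

lemma cs_simps [simp]: "cs 0 = 0" "cs 1 = 1" "- cs a = cs (- a)"
    "cs a + cs b = cs (a + b)" "cs a - cs b = cs (a - b)"
    "cs a * cs b = cs (a * b)"
proof -
  show "- cs a = cs (- a)" "cs 0 = 0" "cs 1 = 1" "cs a + cs b = cs (a + b)" "cs a - cs b = cs (a - b)"
    by (transfer; simp add: mat_def vec_eq_iff)+
  show "cs a * cs b = cs (a * b)"
    by transfer (unfold vec_eq_iff mat_mult_entry, simp add: mat_def)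
qed

lemma cs_commute: "X * cs c = cs c * X"
  by transfer (simp add: vec_eq_iff mat_mult_entry)

lemma cs_of_real: "cs (of_real r) = of_real r"
  unfolding of_real_def
  by (transfer; simp add: mat_def vec_eq_iff)

section \<open>The exponential of a Banach algebra\<close>

lemma commute_exp:
  fixes X Y :: "'a::{real_normed_algebra_1,banach}"
  assumes "X * Y = Y * X"
  shows "X * exp Y = exp Y * X"
proof -
  have "(\<lambda>n. X * (Y ^ n /\<^sub>R fact n)) sums (X * exp Y)"
    by (intro sums_mult exp_converges)
  moreover have "(\<lambda>n. (Y ^ n /\<^sub>R fact n) * X) sums (exp Y * X)"
    by (intro sums_mult2 exp_converges)
  moreover have "X * (Y ^ n /\<^sub>R fact n) = (Y ^ n /\<^sub>R fact n) * X" for n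
    using power_commuting_commutes[of Y X n] assms by simp
  ultimately show ?thesis using sums_unique2 by fastforce
qed

text \<open>Since \<open>C\<close> commutes with \<open>Y\<close>, the commutator with
  \<open>A\<close> differentiates powers:
  \<open>Y ^ n * A - A * Y ^ n = n * C * Y ^ (n - 1)\<close>. The exponential series then sums to
  \<open>C * exp Y\<close>.\<close>

lemma exp_mult_right_commutator:
  fixes Y A :: "'a::{real_normed_algebra_1,banach}"
  assumes C: "Y * A - A * Y = C" and CY: "Y * C = C * Y"
  shows "exp Y * A = (A + C) * exp Y"
proof -
  have pow: "Y ^ Suc n * A = A * Y ^ Suc n + of_nat (Suc n) * (C * Y ^ n)" for n
  proof (induction n)
    case (Suc n)
    have YC: "Y ^ Suc n * C = C * Y ^ Suc n" by (rule power_commuting_commutes[OF CY])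
    have YA: "Y * A = A * Y + C" using C by (simp add: algebra_simps)
    have "Y ^ Suc (Suc n) * A = Y ^ Suc n * (Y * A)" by (simp only: power_Suc2 mult.assoc)
    also have "\<dots> = (Y ^ Suc n * A) * Y + Y ^ Suc n * C" by (simp only: YA distrib_left mult.assoc)
    also have "\<dots> = A * Y ^ Suc (Suc n) + of_nat (Suc n) * (C * Y ^ Suc n) + C * Y ^ Suc n"
      by (simp only: Suc YC distrib_right) (simp only: power_Suc2 mult.assoc)
    finally show ?case by (simp add: algebra_simps)
  qed (use C in \<open>simp add: algebra_simps\<close>)
  have s1: "(\<lambda>n. (Y ^ n /\<^sub>R fact n) * A) sums (exp Y * A)" by (intro sums_mult2 exp_converges)
  have s2: "(\<lambda>n. A * (Y ^ n /\<^sub>R fact n)) sums (A * exp Y)" by (intro sums_mult exp_converges)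
  have s3: "(\<lambda>n. (Y ^ n /\<^sub>R fact n) * A - A * (Y ^ n /\<^sub>R fact n)) sums (exp Y * A - A * exp Y)"
    by (rule sums_diff[OF s1 s2])
  have eq: "(Y ^ Suc n /\<^sub>R fact (Suc n)) * A - A * (Y ^ Suc n /\<^sub>R fact (Suc n)) = C * (Y ^ n /\<^sub>R fact n)" for n
  proof -
    have "(Y ^ Suc n /\<^sub>R fact (Suc n)) * A - A * (Y ^ Suc n /\<^sub>R fact (Suc n))
        = (of_nat (Suc n) * (C * Y ^ n)) /\<^sub>R fact (Suc n)"
      by (simp only: mult_scaleR_left mult_scaleR_right pow scaleR_right_distrib) simp
    also have "of_nat (Suc n) * (C * Y ^ n) = real (Suc n) *\<^sub>R (C * Y ^ n)"
      by (metis of_real_of_nat_eq scaleR_conv_of_real)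
    also have "(real (Suc n) *\<^sub>R (C * Y ^ n)) /\<^sub>R fact (Suc n) = C * (Y ^ n /\<^sub>R fact n)"
      by (simp add: divide_simps)
    finally show ?thesis .
  qed
  have "(\<lambda>n. (Y ^ Suc n /\<^sub>R fact (Suc n)) * A - A * (Y ^ Suc n /\<^sub>R fact (Suc n))) sums (exp Y * A - A * exp Y)"
    using s3 by (subst sums_Suc_iff) simp
  then have "(\<lambda>n. C * (Y ^ n /\<^sub>R fact n)) sums (exp Y * A - A * exp Y)" by (simp only: eq)
  moreover have "(\<lambda>n. C * (Y ^ n /\<^sub>R fact n)) sums (C * exp Y)" by (intro sums_mult exp_converges)
  ultimately have "exp Y * A - A * exp Y = C * exp Y" using sums_unique2 by blast
  then show ?thesis by (simp add: algebra_simps)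
qed

text \<open>All terms of order two and more vanish on \<open>W\<close>. This is how an exponential
  acts on a Jordan chain of length two.\<close>

lemma exp_mult_square_annihilated:
  fixes N W :: "'a::{real_normed_algebra_1,banach}"
  assumes "N * (N * W) = 0"
  shows "exp N * W = W + N * W"
proof -
  have z: "(N ^ n /\<^sub>R fact n) * W = 0" if n: "n \<notin> {0,1}" for n
  proof -
    obtain m where "n = Suc (Suc m)" using n by (metis insertCI not0_implies_Suc One_nat_def)
    then have "N ^ n * W = N ^ m * (N * (N * W))" by (simp only: power_Suc2 mult.assoc)
    then show ?thesis using assms by simp
  qed
  have "(\<lambda>n. (N ^ n /\<^sub>R fact n) * W) sums (\<Sum>n\<in>{0,1}. (N ^ n /\<^sub>R fact n) * W)"
    by (rule sums_finite) (use z in auto)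
  moreover have "(\<lambda>n. (N ^ n /\<^sub>R fact n) * W) sums (exp N * W)"
    by (intro sums_mult2 exp_converges)
  ultimately show ?thesis using sums_unique2 by fastforce
qed

text \<open>\<open>F\<close> is the power series of \<open>(exp z - 1) / z\<close> at
  \<open>N\<close>. Its constant term 1 makes it the identity on the kernel of \<open>N\<close>; if
  \<open>exp N = 1\<close>, it also annihilates the range of \<open>N\<close>, as a spectral
  projection does.\<close>

lemma exp_minus_one_factor:
  fixes N :: "'a::{real_normed_algebra_1,banach}"
  obtains F where "F * N = exp N - 1" "\<And>R. N * R = 0 \<Longrightarrow> F * R = R"
proof -
  define f where "f n = N ^ n /\<^sub>R fact (Suc n)" for n
  have sum: "summable f"
  proof (rule summable_comparison_test')
    show "summable (\<lambda>n. norm (N ^ n /\<^sub>R fact n))" by (rule summable_norm_exp)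
    fix n :: nat
    show "norm (f n) \<le> norm (N ^ n /\<^sub>R fact n)"
      by (simp add: f_def divide_simps mult_le_cancel_right1 del: fact_Suc) (simp add: fact_mono mult_mono)
  qed
  show thesis
  proof
    have "(\<lambda>n. f n * N) sums (suminf f * N)" by (intro sums_mult2 summable_sums sum)
    moreover have "(\<lambda>n. f n * N) sums (exp N - 1)"
    proof -
      have "f n * N = N ^ Suc n /\<^sub>R fact (Suc n)" for n
        unfolding f_def by (simp only: power_Suc2 mult_scaleR_left)
      moreover have "(\<lambda>n. N ^ Suc n /\<^sub>R fact (Suc n)) sums (exp N - 1)"
        using exp_converges[of N] by (subst sums_Suc_iff) simp
      ultimately show ?thesis by (simp only:)
    qed
    ultimately show "suminf f * N = exp N - 1" using sums_unique2 by blast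
  next
    fix R assume R: "N * R = 0"
    have z: "f n * R = 0" if n: "n \<notin> {0}" for n
    proof -
      obtain m where "n = Suc m" using n by (cases n) auto
      then have "N ^ n * R = N ^ m * (N * R)" by (simp only: power_Suc2 mult.assoc)
      then show ?thesis using R by (simp add: f_def)
    qed
    have "(\<lambda>n. f n * R) sums (\<Sum>n\<in>{0}. f n * R)"
      by (rule sums_finite) (use z in auto)
    moreover have "(\<lambda>n. f n * R) sums (suminf f * R)" by (intro sums_mult2 summable_sums sum)
    ultimately show "suminf f * R = R" using sums_unique2 by (fastforce simp: f_def)
  qed
qed

lemma exp_has_derivative_0:
  "((exp :: 'a::{real_normed_algebra_1,banach} \<Rightarrow> 'a) has_derivative (\<lambda>h. h)) (at 0)"
proof -
  \<comment> \<open>Term by term, the remainder is dominated by that of the real exponential at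
    \<open>norm h\<close>.\<close>
  have bound: "norm (exp h - 1 - h) \<le> exp (norm h) - 1 - norm h" for h :: 'a
  proof -
    have a: "(\<lambda>n. h ^ Suc (Suc n) /\<^sub>R fact (Suc (Suc n))) sums (exp h - 1 - h)"
      using exp_converges[of h] by (subst sums_Suc_iff, subst sums_Suc_iff) simp
    have b: "(\<lambda>n. norm h ^ Suc (Suc n) /\<^sub>R fact (Suc (Suc n))) sums (exp (norm h) - 1 - norm h)"
      using exp_converges[of "norm h"] by (subst sums_Suc_iff, subst sums_Suc_iff) simp
    have c: "norm (h ^ n /\<^sub>R fact n) \<le> norm h ^ n /\<^sub>R fact n" for n
      by (simp add: norm_power_ineq mult_left_mono)
    show ?thesis
      using norm_suminf_le[where f="\<lambda>n. h ^ Suc (Suc n) /\<^sub>R fact (Suc (Suc n))", OF c sums_summable[OF b]] a b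
      by (simp only: sums_iff)
  qed
  have "((\<lambda>r::real. (exp r - 1) / r) \<longlongrightarrow> 1) (at 0)"
    using DERIV_exp[of "0::real"] by (simp add: has_field_derivative_iff)
  then have "((\<lambda>r::real. (exp r - 1) / r - 1) \<longlongrightarrow> 1 - 1) (at 0)" by (intro tendsto_intros)
  moreover have "filterlim (norm :: 'a \<Rightarrow> real) (at 0) (at 0)"
    by (auto simp: filterlim_at eventually_at_filter intro!: tendsto_eq_intros)
  ultimately have lim: "((\<lambda>h::'a. (exp (norm h) - 1) / norm h - 1) \<longlongrightarrow> 0) (at 0)"
    using filterlim_compose by fastforce
  show ?thesis
    unfolding has_derivative_at
  proof (intro conjI bounded_linear_ident)
    show "(\<lambda>h. norm (exp (0 + h) - exp (0::'a) - h) / norm h) \<midarrow>0\<rightarrow> 0"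
    proof (rule Lim_null_comparison[OF _ lim])
      have "norm (norm (exp (0 + h) - exp (0::'a) - h) / norm h) \<le> (exp (norm h) - 1) / norm h - 1" if "h \<noteq> 0" for h
        using bound[of h] that by (simp add: divide_simps)
      then show "\<forall>\<^sub>F h in at 0. norm (norm (exp (0 + h) - exp (0::'a) - h) / norm h) \<le> (exp (norm h) - 1) / norm h - 1"
        by (auto simp: eventually_at_filter)
    qed
  qed
qed

text \<open>Commutativity allows the factorization
  \<open>exp (X s) = exp (X s - X t) * exp (X t)\<close>, which leaves only the derivative of
  \<open>exp\<close> at 0.\<close>

lemma exp_has_vector_derivative_commuting:
  fixes X :: "real \<Rightarrow> 'a::{real_normed_algebra_1,banach}"
  assumes d: "(X has_vector_derivative D) (at t within S)" and t: "t \<in> S"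
    and comm: "\<And>s. s \<in> S \<Longrightarrow> X s * X t = X t * X s"
  shows "((\<lambda>s. exp (X s)) has_vector_derivative D * exp (X t)) (at t within S)"
proof -
  have "((\<lambda>s. X s - X t) has_derivative (\<lambda>h. h *\<^sub>R D)) (at t within S)"
    using d by (auto simp: has_vector_derivative_def intro!: derivative_eq_intros)
  then have "((\<lambda>s. exp (X s - X t)) has_derivative (\<lambda>h. h *\<^sub>R D)) (at t within S)"
    by (rule has_derivative_compose) (simp add: exp_has_derivative_0)
  then have "((\<lambda>s. exp (X s - X t) * exp (X t)) has_derivative (\<lambda>h. h *\<^sub>R D * exp (X t))) (at t within S)"
    by (rule has_derivative_mult_left)
  then have "((\<lambda>s. exp (X s - X t) * exp (X t)) has_vector_derivative D * exp (X t)) (at t within S)"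
    by (simp add: has_vector_derivative_def)
  then show ?thesis
  proof (rule has_vector_derivative_transform[OF t, rotated])
    fix s assume "s \<in> S"
    then have "(X s - X t) * X t = X t * (X s - X t)" by (simp add: algebra_simps comm)
    from exp_add_commuting[OF this] show "exp (X s) = exp (X s - X t) * exp (X t)" by simp
  qed
qed

section \<open>Logarithms in the double commutant\<close>

lemma cs_left_commute: "X * (cs c * Y) = cs c * (X * Y)"
  by (metis cs_commute mult.assoc)

section \<open>Polynomials at a matrix and annihilating products of linear factors\<close>

definition peval :: "complex poly \<Rightarrow> 'n::finite cmat \<Rightarrow> 'n cmat" where
  "peval p M = (\<Sum>i\<le>degree p. cs (coeff p i) * M ^ i)"

lemma peval_altdef: "degree p \<le> n \<Longrightarrow> peval p M = (\<Sum>i\<le>n. cs (coeff p i) * M ^ i)"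
  unfolding peval_def by (rule sum.mono_neutral_left) (auto simp: coeff_eq_0)

lemma peval_diff: "peval (p - q) M = peval p M - peval q M"
proof -
  define n where "n = max (degree p) (degree q)"
  have "degree p \<le> n" "degree q \<le> n" "degree (p - q) \<le> n"
    by (auto simp: n_def intro: degree_diff_le_max)
  then show ?thesis
    by (simp add: peval_altdef[of _ n] sum_subtractf[symmetric] left_diff_distrib[symmetric])
qed

lemma peval_smult: "peval (smult c p) M = cs c * peval p M"
  by (simp add: peval_altdef[of _ "degree p"] sum_distrib_left mult.assoc[symmetric])

lemma peval_pCons_0: "peval (pCons 0 p) M = M * peval p M"
proof -
  have "peval (pCons 0 p) M = (\<Sum>i\<le>Suc (degree p). cs (coeff (pCons 0 p) i) * M ^ i)"
    by (rule peval_altdef) (rule degree_pCons_le)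
  also have "\<dots> = (\<Sum>i\<le>degree p. cs (coeff p i) * M ^ Suc i)"
    by (subst sum.atMost_Suc_shift) simp
  also have "\<dots> = (\<Sum>i\<le>degree p. M * (cs (coeff p i) * M ^ i))"
    by (intro sum.cong refl) (simp only: cs_left_commute power_Suc)
  finally show ?thesis by (simp add: peval_def sum_distrib_left)
qed

lemma peval_linear_factor: "peval ([:- c, 1:] * p) M = (M - cs c) * peval p M"
proof -
  have "[:- c, 1:] * p = pCons 0 p - smult c p" by simp
  then show ?thesis by (simp only: peval_diff peval_smult peval_pCons_0 left_diff_distrib)
qed

lemma exists_annihilating_poly:
  obtains p where "p \<noteq> 0" "peval p (M :: 'n::finite cmat) = 0"
proof -
  define d where "d = DIM(complex^'n^'n)"
  define f where "f i = mat_of (M ^ i)" for i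
  have "\<exists>u. (\<exists>i\<le>d. u i \<noteq> 0) \<and> (\<Sum>i\<le>d. u i *\<^sub>R f i) = 0"
  \<comment> \<open>More than \<open>d\<close> vectors in a space of dimension \<open>d\<close> are
    dependent. Dependence concerns sets, so a repetition among the powers, which is itself a
    relation, is treated apart.\<close>
  proof (cases "inj_on f {..d}")
    case True
    then have "card (f ` {..d}) > d" by (simp add: card_image)
    then have "dependent (f ` {..d})" unfolding d_def using dependent_biggerset by blast
    then obtain u where u: "\<exists>v\<in>f ` {..d}. u v \<noteq> 0" "(\<Sum>v\<in>f ` {..d}. u v *\<^sub>R v) = 0"
      by (auto simp: dependent_finite)
    then show ?thesis
      using True by (intro exI[of _ "\<lambda>i. u (f i)"]) (auto simp: sum.reindex)
  next
    case False
    then obtain i j where ij: "i \<le> d" "j \<le> d" "i \<noteq> j" "f i = f j" by (auto simp: inj_on_def)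
    have "(\<Sum>k\<le>d. (if k = i then 1 else if k = j then -1 else 0) *\<^sub>R f k)
        = (\<Sum>k\<le>d. (if k = i then f k else 0) - (if k = j then f k else 0))"
      using ij by (intro sum.cong) auto
    also have "\<dots> = 0" using ij by (simp add: sum_subtractf)
    finally show ?thesis using ij(1)
      by (intro exI[of _ "\<lambda>k. if k = i then 1 else if k = j then -1 else 0"]) auto
  qed
  then obtain u where u: "\<exists>i\<le>d. u i \<noteq> 0" "(\<Sum>i\<le>d. u i *\<^sub>R f i) = 0" by blast
  define p where "p = (\<Sum>i\<le>d. monom (complex_of_real (u i)) i)"
  have cp: "coeff p k = (if k \<le> d then of_real (u k) else 0)" for k
    by (simp add: p_def coeff_sum)
  have "degree p \<le> d" by (rule degree_le) (simp add: cp)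
  then have "peval p M = (\<Sum>i\<le>d. u i *\<^sub>R M ^ i)"
    by (simp add: peval_altdef[of p d] cp cs_of_real scaleR_conv_of_real)
  moreover have "mat_of (\<Sum>i\<le>d. u i *\<^sub>R M ^ i) = mat_of 0"
    using u(2) by (simp add: f_def bounded_linear_mat_of[THEN bounded_linear.linear, THEN linear_sum]
        scaleR_cmat.rep_eq zero_cmat.rep_eq)
  ultimately have "peval p M = 0" by (simp add: mat_of_inject)
  moreover have "p \<noteq> 0" using u(1) cp by (metis coeff_0 of_real_eq_0_iff)
  ultimately show thesis using that by blast
qed

definition lprod :: "complex list \<Rightarrow> 'n::finite cmat \<Rightarrow> 'n cmat" where
  "lprod l M = prod_list (map (\<lambda>c. M - cs c) l)"

lemma lprod_simps [simp]: "lprod [] M = 1" "lprod (c # l) M = (M - cs c) * lprod l M"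
  by (simp_all add: lprod_def)

lemma lprod_commute: "X * M = M * X \<Longrightarrow> lprod l M * X = X * lprod l M"
proof (induction l)
  case (Cons c l)
  have "(M - cs c) * X = X * (M - cs c)" using Cons.prems by (simp add: algebra_simps cs_commute)
  then show ?case using Cons by (metis lprod_simps(2) mult.assoc)
qed simp

lemma exists_annihilating_lprod:
  obtains l where "lprod l (M :: 'n::finite cmat) = 0"
proof -
  have *: "p \<noteq> 0 \<Longrightarrow> \<exists>a l. a \<noteq> 0 \<and> peval p M = cs a * lprod l M" for p
  proof (induction "degree p" arbitrary: p)
    case 0
    then obtain a where "p = [:a:]" by (metis degree_eq_zeroE)
    then show ?case using 0 by (intro exI[of _ a] exI[of _ "[]"]) (simp add: peval_def)
  next
    case (Suc n)
    then have "\<not> constant (poly p)" by (simp add: constant_degree)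
    then obtain c where "poly p c = 0" using fundamental_theorem_of_algebra by blast
    then obtain q where q: "p = [:- c, 1:] * q" by (metis dvdE poly_eq_0_iff_dvd)
    then have "q \<noteq> 0" using Suc by auto
    then have "degree q = n" using Suc(2) q by (simp add: degree_mult_eq del: mult_pCons_left)
    then obtain a l where al: "a \<noteq> 0" "peval q M = cs a * lprod l M" using Suc(1) \<open>q \<noteq> 0\<close> by blast
    then have "peval p M = cs a * lprod (c # l) M"
      by (simp only: q peval_linear_factor cs_left_commute lprod_simps)
    then show ?case using al by blast
  qed
  obtain p where p: "p \<noteq> 0" "peval p M = 0" by (rule exists_annihilating_poly)
  then obtain a l where al: "a \<noteq> 0" "peval p M = cs a * lprod l M" using * by blast
  then have "cs (inverse a) * (cs a * lprod l M) = 0" using p by simp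
  then have "lprod l M = 0" using al(1) by (simp only: mult.assoc[symmetric]) simp
  then show thesis by (rule that)
qed

text \<open>A factor with root 0 is \<open>U\<close> itself and is cancelled by the left inverse
  \<open>V\<close>. The right factor \<open>Y\<close> absorbs the other factors during the
  induction.\<close>

lemma lprod_remove_zeros:
  assumes "V * U = 1" "lprod l U * Y = 0"
  shows "lprod (filter (\<lambda>c. c \<noteq> 0) l) U * Y = 0"
  using assms(2)
proof (induction l arbitrary: Y)
  case (Cons c l)
  show ?case
  proof (cases "c = 0")
    case True
    then have "V * (U * (lprod l U * Y)) = 0" using Cons.prems by (simp add: mult.assoc)
    then have "lprod l U * Y = 0" using assms(1) by (simp add: mult.assoc[symmetric])
    then show ?thesis using Cons.IH True by simp
  next
    case False
    have com: "(U - cs c) * U = U * (U - cs c)" by (simp add: algebra_simps cs_commute)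
    have "lprod l U * ((U - cs c) * Y) = 0"
      using Cons.prems lprod_commute[OF com] by (simp add: mult.assoc[symmetric])
    from Cons.IH[OF this] show ?thesis
      using False lprod_commute[OF com] by (simp add: mult.assoc[symmetric])
  qed
qed simp

lemma bounded_linear_cs: "bounded_linear (cs :: complex \<Rightarrow> 'n::finite cmat)"
proof -
  have "linear (cs :: complex \<Rightarrow> 'n cmat)"
  proof (rule linearI)
    show "cs (r *\<^sub>R c) = r *\<^sub>R (cs c :: 'n cmat)" for r c
      by (metis cs_of_real cs_simps(6) scaleR_conv_of_real)
  qed simp
  then show ?thesis by (simp add: linear_conv_bounded_linear)
qed

lemma cs_power: "cs (c ^ n) = cs c ^ n"
  by (induction n) (simp_all flip: cs_simps(6))

lemma exp_cs: "exp (cs c) = cs (exp c)"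
proof -
  have "(\<lambda>n. cs (c ^ n /\<^sub>R fact n)) sums cs (exp c)"
    by (rule bounded_linear.sums[OF bounded_linear_cs exp_converges])
  then have "(\<lambda>n. cs c ^ n /\<^sub>R fact n) sums cs (exp c)"
    by (simp add: cs_power linear_scale[OF bounded_linear.linear[OF bounded_linear_cs]])
  then show ?thesis using exp_converges[of "cs c"] sums_unique2 by blast
qed

text \<open>The division of the annihilating polynomial by \<open>a U + b\<close> is carried out uniformly in the
  parameter, so that the inverse of \<open>a U + b\<close> comes out as a continuous function.\<close>

lemma lprod_division_continuous:
  fixes U :: "'n::finite cmat" and a b :: "real \<Rightarrow> complex"
  assumes "continuous_on S a" "continuous_on S b"
  shows "\<exists>k G n. continuous_on S k \<and> continuous_on S G \<and>
    (\<forall>t. cs (a t ^ n) * lprod l U = cs (k t) + (cs (a t) * U + cs (b t)) * G t \<and> U * G t = G t * U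
     \<and> k t = (\<Prod>c\<leftarrow>l. - (b t + a t * c)))"
proof (induction l)
  case Nil
  show ?case by (rule exI[of _ "\<lambda>_. 1"], rule exI[of _ "\<lambda>_. 0"], rule exI[of _ 0]) (auto)
next
  case (Cons c l)
  then obtain k G n where *: "continuous_on S k" "continuous_on S G"
    "\<And>t. cs (a t ^ n) * lprod l U = cs (k t) + (cs (a t) * U + cs (b t)) * G t"
    "\<And>t. U * G t = G t * U" "\<And>t. k t = (\<Prod>c\<leftarrow>l. - (b t + a t * c))" by blast
  define x where "x t = cs (a t) * U + cs (b t)" for t
  define W where "W t = cs (a t) * (U - cs c)" for t
  define e where "e t = b t + a t * c" for t
  \<comment> \<open>With \<open>W t = x t - cs (e t)\<close>, multiplying
    \<open>cs (k t) + x t * G t\<close> by \<open>W t\<close> gives \<open>- e t * k t\<close> as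
    remainder and this as quotient by \<open>x t\<close>.\<close>
  define G' where "G' t = cs (k t) + W t * G t" for t
  have W: "W t = x t - cs (e t)" for t
  proof -
    have "(cs (e t) :: 'n cmat) = cs (b t) + cs (a t) * cs c" by (simp add: e_def)
    then show ?thesis unfolding W_def x_def by (simp only: right_diff_distrib add_diff_add) (simp del: cs_simps)
  qed
  have UW: "U * W t = W t * U" for t
  proof -
    have "U * (U - cs c) = (U - cs c) * U" by (simp add: algebra_simps cs_commute)
    then show ?thesis by (simp add: W_def cs_left_commute mult.assoc)
  qed
  have c1: "continuous_on S (\<lambda>t. - e t * k t)" and c2: "continuous_on S G'"
    unfolding G'_def W_def e_def
    by (intro continuous_intros bounded_linear.continuous_on[OF bounded_linear_cs] * assms)+
  have c3: "cs (a t ^ Suc n) * lprod (c # l) U = cs (- e t * k t) + (cs (a t) * U + cs (b t)) * G' t" for t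
  proof -
    have "cs (a t ^ Suc n) * lprod (c # l) U = W t * (cs (a t ^ n) * lprod l U)"
      by (simp only: W_def mult.assoc cs_left_commute[of "U - cs c"] lprod_simps power_Suc cs_simps(6)[symmetric])
    also have "\<dots> = W t * cs (k t) + W t * x t * G t"
      by (simp add: *(3) distrib_left mult.assoc flip: x_def)
    also have "W t * x t = x t * W t" by (simp add: W algebra_simps cs_commute)
    also have "W t * cs (k t) = cs (- e t * k t) + x t * cs (k t)" by (simp add: W algebra_simps flip: cs_simps(3))
    finally show ?thesis by (simp only: G'_def x_def[symmetric] distrib_left mult.assoc add.assoc)
  qed
  have c4: "U * G' t = G' t * U" for t
  proof -
    have "U * (W t * G t) = W t * (U * G t)" by (simp only: mult.assoc[symmetric] UW)
    also have "\<dots> = W t * G t * U" by (simp only: mult.assoc *(4))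
    finally show ?thesis by (simp only: G'_def distrib_left distrib_right cs_commute)
  qed
  have c5: "- e t * k t = (\<Prod>c\<leftarrow>c # l. - (b t + a t * c))" for t by (simp add: e_def *(5))
  show ?case
    by (rule exI[of _ "\<lambda>t. - e t * k t"], rule exI[of _ G'], rule exI[of _ "Suc n"])
      (intro conjI allI c1 c2 c3 c4 c5)
qed

text \<open>The path \<open>M t = g t * U + (1 - g t)\<close> runs from 1 to \<open>U\<close>
  through invertible matrices, and \<open>X\<close> integrates its logarithmic derivative. The
  inverses commute with everything that commutes with \<open>U\<close>, hence so does the
  integral.\<close>

lemma exists_double_commutant_log:
  fixes U :: "'n::finite cmat"
  assumes inv: "V * U = 1"
  obtains X where "exp X = U" "\<And>W. W * U = U * W \<Longrightarrow> W * X = X * W"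
proof -
  obtain l0 where "lprod l0 U = 0" by (rule exists_annihilating_lprod)
  define l where "l = filter (\<lambda>c. c \<noteq> 0) l0"
  have l: "lprod l U = 0" "0 \<notin> set l"
    using lprod_remove_zeros[OF inv, of l0 1] \<open>lprod l0 U = 0\<close> by (auto simp: l_def)
  \<comment> \<open>For \<open>c\<close> other than 1 the factor \<open>1 - z + z * c\<close>
    vanishes at \<open>z = 1 / (1 - c)\<close>, so that \<open>z * U + (1 - z)\<close> may be
    singular there.\<close>
  define bad where "bad = (\<lambda>c. 1 / (1 - c)) ` set l"
  have "finite ((\<lambda>z. Im z / (Re z * (1 - Re z))) ` bad)" by (simp add: bad_def)
  then obtain s where s: "s \<notin> (\<lambda>z. Im z / (Re z * (1 - Re z))) ` bad"
    using ex_new_if_finite infinite_UNIV_char_0 by blast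
  \<comment> \<open>A parabolic arc from 0 to 1. Away from \<open>Re z = 0\<close> and
    \<open>Re z = 1\<close>, a bad point lies on it for a single height \<open>s\<close>, and
    \<open>s\<close> avoids these finitely many values.\<close>
  define g where "g t = Complex t (s * (t * (1 - t)))" for t
  define g' where "g' t = Complex 1 (s * (1 - 2 * t))" for t
  have g: "(g has_vector_derivative g' t) (at t within S)" for t S
    unfolding g_def g'_def Complex_eq has_vector_derivative_def
    by (auto intro!: derivative_eq_intros simp: scaleR_conv_of_real algebra_simps)
  have nz: "1 - g t + g t * c \<noteq> 0" if c: "c \<in> set l" for t c
  proof
    assume eq: "1 - g t + g t * c = 0"
    then have "c \<noteq> 1" by auto
    then have gt: "g t = 1 / (1 - c)" using eq by (simp add: field_simps)
    then have "g t \<in> bad" using c by (auto simp: bad_def)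
    then have "s \<noteq> Im (g t) / (Re (g t) * (1 - Re (g t)))" using s by blast
    then have "s \<noteq> s * (t * (1 - t)) / (t * (1 - t))" unfolding g_def complex.sel .
    then have "t * (1 - t) = 0" using nonzero_mult_div_cancel_right[of "t * (1 - t)" s] by metis
    then have "g t = 0 \<or> g t = 1" by (auto simp: g_def complex_eq_iff)
    \<comment> \<open>At the endpoints, \<open>1 / (1 - c)\<close> cannot be 0, and it can be 1 only
      for \<open>c = 0\<close>.\<close>
    moreover have "c \<noteq> 0" using l c by auto
    ultimately show False using gt \<open>c \<noteq> 1\<close> by auto
  qed
  have contg: "continuous_on {0..1} g"
    unfolding g_def Complex_eq by (intro continuous_intros)
  have contg': "continuous_on {0..1} g'"
    unfolding g'_def Complex_eq by (intro continuous_intros)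
  define M where "M t = cs (g t) * U + cs (1 - g t)" for t
  have "continuous_on {0..1} (\<lambda>t. 1 - g t)" by (intro continuous_intros contg)
  from lprod_division_continuous[OF contg this, of l U] obtain k G n where
    kG: "continuous_on {0..1} k" "continuous_on {0..1} G"
    "\<And>t. cs (g t ^ n) * lprod l U = cs (k t) + M t * G t"
    "\<And>t. U * G t = G t * U" "\<And>t. k t = (\<Prod>c\<leftarrow>l. - (1 - g t + g t * c))"
    unfolding M_def by blast
  have knz: "k t \<noteq> 0" for t
    using nz[of _ t] unfolding kG(5) prod_list_zero_iff set_map image_iff by (metis neg_equal_0_iff_equal)
  \<comment> \<open>As \<open>lprod l U = 0\<close>, the division reads
    \<open>M t * G t = cs (- k t)\<close>, so this is the inverse of \<open>M t\<close>.\<close>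
  define J where "J t = cs (- inverse (k t)) * G t" for t
  have contJ: "continuous_on {0..1} J"
    unfolding J_def
    by (intro continuous_intros bounded_linear.continuous_on[OF bounded_linear_cs] kG) (use knz in auto)
  have MG: "M t * G t = cs (- k t)" for t
    using kG(3)[of t] l(1) by (simp add: add_eq_0_iff2 flip: cs_simps(3))
  have UJ: "U * J t = J t * U" for t
    unfolding J_def by (simp add: cs_left_commute kG(4) mult.assoc)
  have MJ: "M t * J t = 1" for t
    using knz[of t] by (simp add: J_def cs_left_commute MG)
  have JM: "J t * M t = 1" for t
    using MJ[of t] UJ[of t] by (simp add: M_def algebra_simps cs_commute cs_left_commute)
  define f where "f t = cs (g' t) * (U - 1) * J t" for t
  have contf: "continuous_on {0..1} f"
    unfolding f_def by (intro continuous_intros bounded_linear.continuous_on[OF bounded_linear_cs] contg' contJ)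
  define X where "X t = integral {0..t} f" for t
  have X: "(X has_vector_derivative f t) (at t within {0..1})" if "t \<in> {0..1}" for t
    unfolding X_def using integral_has_vector_derivative[OF contf that] .
  have comm: "W * X t = X t * W" if W: "W * U = U * W" and t: "t \<in> {0..1}" for W t
  proof -
    have WM: "W * M t = M t * W" for t by (simp add: M_def algebra_simps cs_commute cs_left_commute W)
    have WJ: "W * J t = J t * W" for t
    proof -
      have "W * J t = J t * M t * W * J t" by (simp add: JM)
      also have "\<dots> = J t * W * (M t * J t)" by (metis WM mult.assoc)
      finally show ?thesis by (simp add: MJ)
    qed
    have Wf: "W * f t = f t * W" for t
    proof -
      have "W * f t = cs (g' t) * ((W * (U - 1)) * J t)" by (simp add: f_def cs_left_commute mult.assoc)
      also have "W * (U - 1) = (U - 1) * W" using W by (simp add: algebra_simps)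
      finally show ?thesis by (simp add: f_def mult.assoc WJ)
    qed
    have int: "f integrable_on {0..t}"
      using contf t by (intro integrable_continuous_real) (auto intro: continuous_on_subset)
    have "W * X t = integral {0..t} (\<lambda>s. W * f s)"
      unfolding X_def using integral_linear[OF int bounded_linear_mult_right[of W]] by (simp add: o_def)
    also have "\<dots> = integral {0..t} (\<lambda>s. f s * W)" by (simp add: Wf)
    also have "\<dots> = X t * W"
      unfolding X_def using integral_linear[OF int bounded_linear_mult_left[of W]] by (simp add: o_def)
    finally show ?thesis .
  qed
  have XU: "U * X t = X t * U" if "t \<in> {0..1}" for t using comm[OF _ that] by simp
  have XX: "X s * X t = X t * X s" if "s \<in> {0..1}" "t \<in> {0..1}" for s t
    using comm[OF _ that(2), of "X s"] XU[OF that(1)] by simp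
  \<comment> \<open>This is constant because \<open>f t * M t\<close> is the derivative of
    \<open>M\<close>; its values at 0 and 1 give \<open>exp (- X 1) * U = 1\<close>.\<close>
  define h where "h t = exp (- X t) * M t" for t
  have h: "(h has_vector_derivative 0) (at t within {0..1})" if t: "t \<in> {0..1}" for t
  proof -
    have e: "((\<lambda>s. exp (- X s)) has_vector_derivative (- f t) * exp (- X t)) (at t within {0..1})"
      by (rule exp_has_vector_derivative_commuting[OF has_vector_derivative_minus[OF X[OF t]] t])
        (use XX t in auto)
    have "((\<lambda>t. cs (g t) * (U - 1) + 1) has_vector_derivative cs (g' t) * (U - 1)) (at t within {0..1})"
      by (intro has_vector_derivative_add_const[THEN iffD2] has_vector_derivative_mult_left
        bounded_linear.has_vector_derivative[OF bounded_linear_cs g])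
    moreover have "M = (\<lambda>t. cs (g t) * (U - 1) + 1)"
      by (rule ext) (simp add: M_def algebra_simps flip: cs_simps(5))
    ultimately have m: "(M has_vector_derivative cs (g' t) * (U - 1)) (at t within {0..1})" by simp
    have "U * exp (- X t) = exp (- X t) * U"
      by (rule commute_exp) (simp add: XU[OF t])
    then have eM: "exp (- X t) * M t = M t * exp (- X t)"
      by (simp add: M_def algebra_simps cs_commute cs_left_commute)
    have eU: "exp (- X t) * (cs (g' t) * (U - 1)) = cs (g' t) * (U - 1) * exp (- X t)"
      using \<open>U * exp (- X t) = exp (- X t) * U\<close> by (simp add: cs_left_commute algebra_simps cs_commute)
    have "- f t * exp (- X t) * M t = - (f t * M t) * exp (- X t)"
      by (simp add: mult.assoc eM)
    also have "f t * M t = cs (g' t) * (U - 1)" by (simp add: f_def mult.assoc JM)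
    finally have "exp (- X t) * (cs (g' t) * (U - 1)) + - f t * exp (- X t) * M t = 0"
      by (simp add: eU)
    with has_vector_derivative_mult[OF e m] show ?thesis
      unfolding h_def by simp
  qed
  have "h 1 = h 0"
  proof -
    obtain c where "\<And>t. t \<in> {0..1} \<Longrightarrow> h t = c"
      using has_vector_derivative_zero_constant[of "{0..1}" h] h by (auto simp: convex_real_interval)
    then show ?thesis by simp
  qed
  moreover have "g 0 = 0" "g 1 = 1" by (simp_all add: g_def complex_eq_iff)
  moreover have "X 0 = 0" by (simp add: X_def)
  ultimately have "exp (- X 1) * U = 1" by (simp add: h_def M_def)
  then have "exp (X 1) * (exp (- X 1) * U) = exp (X 1)" by simp
  then have "exp (X 1) = U" by (simp add: mult.assoc[symmetric] exp_minus_inverse)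
  then show thesis using comm[of _ 1] that by simp
qed

section \<open>Matrices with trivial exponential\<close>

lemma cs_cancel: "c \<noteq> 0 \<Longrightarrow> cs (inverse c) * (cs c * X) = X" "c \<noteq> 0 \<Longrightarrow> cs c * (cs (inverse c) * X) = X"
  by (simp_all add: mult.assoc[symmetric])

lemma cs_mult_eq_0_iff: "cs c * X = 0 \<longleftrightarrow> c = 0 \<or> X = 0"
  by (metis cs_cancel(1) cs_simps(1) mult_zero_left mult_zero_right)

lemma exp_mult_generalized_eigen:
  assumes "(M - cs m) * ((M - cs m) * Z) = 0"
  shows "exp M * Z = cs (exp m) * (Z + (M - cs m) * Z)"
proof -
  have "cs m * (M - cs m) = (M - cs m) * cs m" by (rule cs_commute[symmetric])
  from exp_add_commuting[OF this] have "exp M = cs (exp m) * exp (M - cs m)" by (simp add: exp_cs)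
  then show ?thesis by (simp add: mult.assoc exp_mult_square_annihilated[OF assms])
qed

text \<open>Nonzero matrices \<open>W\<close> serve as eigenvectors: their columns lie in the
  eigenspace, on which \<open>exp M\<close> acts as \<open>exp m\<close>.\<close>

lemma exp_eq_1_eigenvalue:
  assumes "exp M = 1" "(M - cs m) * W = 0" "W \<noteq> 0"
  shows "exp m = 1"
proof -
  have "W = cs (exp m) * W" using exp_mult_generalized_eigen[of M m W] assms by simp
  then have "cs (exp m - 1) * W = 0" by (simp add: left_diff_distrib flip: cs_simps(5))
  then show ?thesis using assms(3) by (simp add: cs_mult_eq_0_iff)
qed

text \<open>A nonzero \<open>(M - cs m) * Z\<close> would be an eigenvector, so
  \<open>exp m = 1\<close>, and \<open>exp M * Z\<close> would differ from \<open>Z\<close> by it.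
  Thus Jordan chains of length two are excluded.\<close>

lemma exp_eq_1_reduced:
  assumes "exp M = 1" "(M - cs m) * ((M - cs m) * Z) = 0"
  shows "(M - cs m) * Z = 0"
proof (rule ccontr)
  assume nz: "(M - cs m) * Z \<noteq> 0"
  then have "exp m = 1" using exp_eq_1_eigenvalue assms by blast
  then show False using exp_mult_generalized_eigen[OF assms(2)] assms(1) nz by simp
qed

lemma lprod_remove1:
  "c \<in> set l \<Longrightarrow> lprod l M = (M - cs c) * lprod (remove1 c l) M"
proof (induction l)
  case (Cons a l)
  have "(M - cs a) * (M - cs c) = (M - cs c) * (M - cs a)"
    by (simp add: left_diff_distrib right_diff_distrib cs_commute[of M] mult.commute[of a c])
  with Cons show ?case by (auto simp flip: mult.assoc)
qed simp

lemma lprod_commute_self: "lprod l M * (M - cs c) = (M - cs c) * lprod l M"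
  by (rule lprod_commute) (simp add: algebra_simps cs_commute)

text \<open>Factors are peeled off an arbitrary annihilating product. For \<open>c\<close> outside
  \<open>gl\<close> the factor is injective; for \<open>c\<close> in \<open>gl\<close> it already
  occurs in \<open>lprod gl M\<close>, and its square has the same kernel as the factor
  itself.\<close>

lemma exp_eq_1_lprod_eq_0:
  fixes M :: "'n::finite cmat"
  assumes M: "exp M = 1" and gl: "\<And>m W. (M - cs m) * W = 0 \<Longrightarrow> W \<noteq> 0 \<Longrightarrow> m \<in> set gl"
  shows "lprod gl M = 0"
proof -
  have *: "lprod l M * Y = 0 \<Longrightarrow> lprod gl M * Y = 0" for l Y
  proof (induction l arbitrary: Y)
    case (Cons c l)
    have "lprod l M * ((M - cs c) * Y) = 0"
      using Cons.prems by (simp add: lprod_commute_self flip: mult.assoc)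
    then have "lprod gl M * ((M - cs c) * Y) = 0" by (rule Cons.IH)
    then have 1: "(M - cs c) * (lprod gl M * Y) = 0" by (simp add: lprod_commute_self flip: mult.assoc)
    show ?case
    proof (cases "c \<in> set gl")
      case True
      note r = lprod_remove1[OF True, of M]
      have "(M - cs c) * ((M - cs c) * (lprod (remove1 c gl) M * Y)) = 0"
        using 1 by (simp add: r mult.assoc)
      from exp_eq_1_reduced[OF M this] show ?thesis by (simp add: r mult.assoc)
    next
      case False
      then show ?thesis using gl 1 by blast
    qed
  qed simp
  obtain l where "lprod l M = 0" by (rule exists_annihilating_lprod)
  then show ?thesis using *[of l 1] by simp
qed

lemma lprod_eigen: "(M - cs m) * W = 0 \<Longrightarrow> lprod l M * W = cs (\<Prod>c\<leftarrow>l. m - c) * W"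
proof (induction l)
  case (Cons c l)
  have "lprod (c # l) M * W = (M - cs c) * (cs (\<Prod>c\<leftarrow>l. m - c) * W)"
    using Cons by (simp add: mult.assoc)
  also have "\<dots> = cs (\<Prod>c\<leftarrow>l. m - c) * ((M - cs m) * W + cs (m - c) * W)"
    by (simp only: cs_left_commute left_diff_distrib cs_simps(5)[symmetric]) simp
  also have "\<dots> = cs (\<Prod>c\<leftarrow>c # l. m - c) * W" by (simp add: Cons.prems mult.assoc[symmetric] mult.commute)
  finally show ?case .
qed simp

lemma exp_eq_1_finite_spectrum:
  fixes M :: "'n::finite cmat"
  assumes M: "exp M = 1"
  obtains gl where "distinct gl" "gl \<noteq> []" "\<And>m. m \<in> set gl \<Longrightarrow> exp m = 1" "lprod gl M = 0"
proof -
  obtain l where l: "lprod l M = 0" by (rule exists_annihilating_lprod)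
  define gl where "gl = remdups (filter (\<lambda>c. exp c = 1) l)"
  have "lprod gl M = 0"
  proof (rule exp_eq_1_lprod_eq_0[OF M])
    fix m W assume W: "(M - cs m) * W = 0" "W \<noteq> 0"
    then have "(\<Prod>c\<leftarrow>l. m - c) = 0" using lprod_eigen[OF W(1), of l] l by (simp add: cs_mult_eq_0_iff)
    then show "m \<in> set gl" using exp_eq_1_eigenvalue[OF M W] by (auto simp: gl_def prod_list_zero_iff)
  qed
  moreover from this have "gl \<noteq> []" by auto
  moreover have "distinct gl" "\<And>m. m \<in> set gl \<Longrightarrow> exp m = 1" by (auto simp: gl_def)
  ultimately show thesis by (intro that)
qed

text \<open>\<open>E\<close> is the spectral projection for \<open>m\<close>; it can be 0 when \<open>m\<close> is not an eigenvalue.\<close>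

definition semisimple :: "'n::finite cmat \<Rightarrow> bool" where
  "semisimple M \<longleftrightarrow> (\<forall>m. \<exists>E. E * (M - cs m) = 0 \<and> (\<forall>R. (M - cs m) * R = 0 \<longrightarrow> E * R = R))"

text \<open>For \<open>exp m = 1\<close> the shifted matrix has exponential 1 too, and the series of
  \<open>(exp z - 1) / z\<close> at it provides the projection. Any other \<open>m\<close> is no
  eigenvalue and takes \<open>E = 0\<close>.\<close>

lemma exp_eq_1_semisimple:
  assumes M: "exp M = 1"
  shows "semisimple M"
  unfolding semisimple_def
proof
  fix m
  show "\<exists>E. E * (M - cs m) = 0 \<and> (\<forall>R. (M - cs m) * R = 0 \<longrightarrow> E * R = R)"
  proof (cases "exp m = 1")
    case True
    have "M * cs (- m) = cs (- m) * M" by (rule cs_commute)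
    from exp_add_commuting[OF this] have "exp (M + cs (- m)) = 1"
      using True M by (simp add: exp_cs exp_minus)
    then have "exp (M - cs m) = 1" by (simp flip: cs_simps(3))
    then show ?thesis using exp_minus_one_factor[of "M - cs m"] by (metis diff_self)
  next
    case False
    then show ?thesis using exp_eq_1_eigenvalue[OF M] by (intro exI[of _ 0]) auto
  qed
qed

lemma semisimple_scale:
  assumes "semisimple (cs c * M)" "c \<noteq> 0"
  shows "semisimple M"
  unfolding semisimple_def
proof
  fix m
  obtain E where E: "E * (cs c * M - cs (c * m)) = 0"
    "\<And>R. (cs c * M - cs (c * m)) * R = 0 \<Longrightarrow> E * R = R"
    using assms(1) unfolding semisimple_def by blast
  have eq: "cs c * M - cs (c * m) = cs c * (M - cs m)" by (simp add: algebra_simps)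
  have "E * (M - cs m) = 0" using E(1) assms(2) by (simp add: eq cs_left_commute cs_mult_eq_0_iff)
  moreover have "E * R = R" if "(M - cs m) * R = 0" for R
    using E(2)[of R] that by (simp add: eq mult.assoc)
  ultimately show "\<exists>E. E * (M - cs m) = 0 \<and> (\<forall>R. (M - cs m) * R = 0 \<longrightarrow> E * R = R)" by blast
qed

text \<open>Independence of eigenvectors for distinct eigenvalues: applying
  \<open>T - cs (t j)\<close> removes the term \<open>j\<close> and multiplies the others by nonzero
  scalars.\<close>

lemma eigen_sum_eq_0:
  assumes "finite I" "inj_on t I" "\<And>i. i \<in> I \<Longrightarrow> T * R i = cs (t i) * R i" "(\<Sum>i\<in>I. R i) = 0" "i \<in> I"
  shows "R i = 0"
  using assms
proof (induction I arbitrary: R i rule: finite_induct)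
  case (insert j I)
  define R' where "R' i = cs (t i - t j) * R i" for i
  have "(\<Sum>i\<in>insert j I. R' i) = (T - cs (t j)) * (\<Sum>i\<in>insert j I. R i)"
    unfolding sum_distrib_left
    by (rule sum.cong) (simp_all add: R'_def insert.prems(2) left_diff_distrib flip: cs_simps(5))
  then have "(\<Sum>i\<in>insert j I. R' i) = 0" using insert.prems(3) by simp
  then have "(\<Sum>i\<in>I. R' i) = 0" using insert.hyps by (simp add: R'_def)
  moreover have "T * R' i = cs (t i) * R' i" if "i \<in> I" for i
    using that insert.prems(2)[of i] by (simp add: R'_def cs_left_commute[of T])
      (simp add: mult.assoc[symmetric] mult.commute)
  ultimately have R': "R' i = 0" if "i \<in> I" for i
    using insert.IH[of R' i] insert.prems(1) that by (simp add: inj_on_def)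
  have R0: "R i = 0" if "i \<in> I" for i
  proof -
    have "t i \<noteq> t j" using insert.prems(1) insert.hyps that by (auto simp: inj_on_def)
    then show ?thesis using R'[OF that] by (simp add: R'_def cs_mult_eq_0_iff)
  qed
  then have "(\<Sum>i\<in>I. R i) = 0" by simp
  then have "R j = 0" using insert by simp
  then show ?case using R0 insert.prems(4) by auto
qed simp

text \<open>First order perturbation theory of a semisimple eigenvalue: the compression of \<open>A\<close> to the
  eigenspace of \<open>M\<close> acts on the \<open>X i\<close> with distinct eigenvalues, so they are independent.\<close>

lemma perturbed_eigen_sum_eq_0:
  assumes "finite I" "semisimple M" "inj_on (\<lambda>i. (l i, a i)) I"
    and e0: "\<And>i. i \<in> I \<Longrightarrow> (M - cs (l i)) * X i = 0"
    and e1: "\<And>i. i \<in> I \<Longrightarrow> (M - cs (l i)) * Y i + (A - cs (a i)) * X i = 0"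
    and s: "(\<Sum>i\<in>I. X i) = 0" and j: "j \<in> I"
  shows "X j = 0"
proof -
  \<comment> \<open>Grouping by eigenvalue of \<open>M\<close>: independence for \<open>M\<close>
    isolates the terms with eigenvalue \<open>l j\<close>, within which the numbers
    \<open>a i\<close> are distinct.\<close>
  define R where "R m = (\<Sum>i\<in>{i \<in> I. l i = m}. X i)" for m
  have "(\<Sum>m\<in>l ` I. R m) = 0"
    unfolding R_def using sum.image_gen[OF \<open>finite I\<close>, of X l] s by simp
  moreover have "M * R m = cs m * R m" for m
    unfolding R_def sum_distrib_left using e0 by (intro sum.cong) (auto simp: left_diff_distrib)
  ultimately have R: "R (l j) = 0"
    using eigen_sum_eq_0[of "l ` I" "\<lambda>m. m" M R "l j"] assms(1) j by simp
  obtain E where E: "E * (M - cs (l j)) = 0" "\<And>R. (M - cs (l j)) * R = 0 \<Longrightarrow> E * R = R"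
    using assms(2) unfolding semisimple_def by blast
  show ?thesis
  proof (rule eigen_sum_eq_0[where I="{i \<in> I. l i = l j}" and t=a and T="E * A"])
    show "finite {i \<in> I. l i = l j}" using assms(1) by simp
    show "inj_on a {i \<in> I. l i = l j}" using assms(3) by (auto simp: inj_on_def)
    show "(\<Sum>i\<in>{i \<in> I. l i = l j}. X i) = 0" using R by (simp add: R_def)
    show "j \<in> {i \<in> I. l i = l j}" using j by simp
    fix i assume "i \<in> {i \<in> I. l i = l j}"
    then have i: "i \<in> I" "l i = l j" by auto
    \<comment> \<open>Multiplying by \<open>E\<close> removes the correction \<open>Y i\<close> and
      turns the first order equation into an eigenvalue equation for \<open>E * A\<close>.\<close>
    have "E * ((M - cs (l i)) * Y i + (A - cs (a i)) * X i) = 0" using e1[OF i(1)] by simp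
    then have "E * A * X i = cs (a i) * (E * X i)"
      using E(1) i(2) by (simp add: distrib_left mult.assoc[symmetric])
        (simp add: left_diff_distrib right_diff_distrib mult.assoc cs_left_commute[of E])
    then show "E * A * X i = cs (a i) * X i" using E(2)[of "X i"] e0[OF i(1)] i(2) by simp
  qed
qed

section \<open>Matrix polynomials in one variable\<close>

text \<open>Polynomial functions of degree at most \<open>d\<close> with matrix coefficients.
  Horner's form exposes the constant term, so that dividing by \<open>z\<close> is a case
  distinction.\<close>

inductive matrix_poly_fun :: "nat \<Rightarrow> (complex \<Rightarrow> 'n::finite cmat) \<Rightarrow> bool" where
  const: "matrix_poly_fun 0 (\<lambda>z. X)"
| horner: "matrix_poly_fun d f \<Longrightarrow> matrix_poly_fun (Suc d) (\<lambda>z. cs z * f z + X)"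

lemma matrix_poly_fun_Suc: "matrix_poly_fun d f \<Longrightarrow> matrix_poly_fun (Suc d) f"
proof (induction rule: matrix_poly_fun.induct)
  case (const X)
  show ?case using horner[OF matrix_poly_fun.const[of 0], of X] by simp
next
  case (horner d f X)
  show ?case by (rule matrix_poly_fun.horner[OF horner.IH])
qed

lemma matrix_poly_fun_mono: "matrix_poly_fun d f \<Longrightarrow> d \<le> e \<Longrightarrow> matrix_poly_fun e f"
  by (induction e) (auto simp: le_Suc_eq intro: matrix_poly_fun_Suc)

lemma matrix_poly_fun_add:
  assumes "matrix_poly_fun d f" "matrix_poly_fun d g"
  shows "matrix_poly_fun d (\<lambda>z. f z + g z)"
  using assms
proof (induction arbitrary: g rule: matrix_poly_fun.induct)
  case (const X)
  then show ?case by (cases rule: matrix_poly_fun.cases) (auto intro: matrix_poly_fun.const)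
next
  case (horner d f X)
  from horner.prems obtain h Y where g: "g = (\<lambda>z. cs z * h z + Y)" "matrix_poly_fun d h"
    by (cases rule: matrix_poly_fun.cases) auto
  have "(\<lambda>z. cs z * f z + X + g z) = (\<lambda>z. cs z * (f z + h z) + (X + Y))"
    by (rule ext) (simp add: g(1) distrib_left)
  then show ?case using matrix_poly_fun.horner[OF horner.IH[OF g(2)], of "X + Y"] by simp
qed

lemma matrix_poly_fun_lmult: "matrix_poly_fun d f \<Longrightarrow> matrix_poly_fun d (\<lambda>z. X * f z)"
proof (induction rule: matrix_poly_fun.induct)
  case (horner d f Y)
  have "(\<lambda>z. X * (cs z * f z + Y)) = (\<lambda>z. cs z * (X * f z) + X * Y)"
    by (rule ext) (simp only: distrib_left cs_left_commute[of X])
  then show ?case using matrix_poly_fun.horner[OF horner.IH] by simp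
qed (rule matrix_poly_fun.const)

lemma matrix_poly_fun_pencil:
  assumes "matrix_poly_fun d f"
  shows "matrix_poly_fun (Suc d) (\<lambda>z. (cs z * X + Y) * f z)"
proof -
  have "matrix_poly_fun (Suc d) (\<lambda>z. cs z * (X * f z) + 0)"
    by (intro matrix_poly_fun.horner matrix_poly_fun_lmult assms)
  from matrix_poly_fun_add[OF this matrix_poly_fun_Suc[OF matrix_poly_fun_lmult[OF assms, of Y]]]
  show ?thesis by (simp add: distrib_right mult.assoc)
qed

lemma matrix_poly_fun_translate: "matrix_poly_fun d f \<Longrightarrow> matrix_poly_fun d (\<lambda>z. f (z + c))"
proof (induction rule: matrix_poly_fun.induct)
  case (horner d f X)
  have "matrix_poly_fun (Suc d) (\<lambda>z. (cs z * 1 + cs c) * f (z + c))"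
    by (rule matrix_poly_fun_pencil) (rule horner.IH)
  from matrix_poly_fun_add[OF this matrix_poly_fun_mono[OF matrix_poly_fun.const[of X]]]
  show ?case by simp
qed (rule matrix_poly_fun.const)

text \<open>Translating \<open>c\<close> to 0 turns the remainder into the constant term of Horner's
  form.\<close>

lemma matrix_poly_fun_divide:
  assumes "matrix_poly_fun (Suc d) f"
  obtains g where "matrix_poly_fun d g" "\<And>z. f z = f c + cs (z - c) * g z"
proof -
  from matrix_poly_fun_translate[OF assms, of c]
  obtain h X where h: "(\<lambda>z. f (z + c)) = (\<lambda>z. cs z * h z + X)" "matrix_poly_fun d h"
    by (cases rule: matrix_poly_fun.cases) auto
  have "f c = X" using fun_cong[OF h(1), of 0] by simp
  then have "f z = f c + cs (z - c) * h (z - c)" for z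
    using fun_cong[OF h(1), of "z - c"] by simp
  moreover have "matrix_poly_fun d (\<lambda>z. h (z - c))" using matrix_poly_fun_translate[OF h(2), of "- c"] by simp
  ultimately show thesis by (intro that)
qed

lemma matrix_poly_fun_eq_0:
  assumes "matrix_poly_fun d f" "infinite S" "\<And>z. z \<in> S \<Longrightarrow> f z = 0"
  shows "f z = 0"
  using assms
proof (induction d arbitrary: f S z)
  case 0
  from 0(1) obtain X where "f = (\<lambda>_. X)" by (cases rule: matrix_poly_fun.cases) auto
  moreover obtain s where "s \<in> S" using infinite_imp_nonempty[OF 0(2)] by blast
  ultimately show ?case using 0(3) by metis
next
  case (Suc d)
  obtain s where s: "s \<in> S" using infinite_imp_nonempty[OF Suc.prems(2)] by blast
  obtain g where g: "matrix_poly_fun d g" "\<And>z. f z = f s + cs (z - s) * g z"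
    using matrix_poly_fun_divide[OF Suc.prems(1), where c=s] by blast
  have "g z = 0" for z
  proof (rule Suc.IH[OF g(1)])
    show "infinite (S - {s})" using Suc.prems(2) by simp
    fix w assume "w \<in> S - {s}"
    then have "f w = 0" "f s = 0" "w \<noteq> s" using Suc.prems(3) s by auto
    then show "g w = 0" using g(2)[of w] by (simp add: cs_mult_eq_0_iff)
  qed
  then show ?case using g(2)[of z] Suc.prems(3)[OF s] by simp
qed

lemma matrix_poly_fun_eq_0_except:
  assumes "matrix_poly_fun d f" "\<And>z. z \<noteq> c \<Longrightarrow> f z = 0"
  shows "f z = 0"
  by (rule matrix_poly_fun_eq_0[OF assms(1), of "UNIV - {c}"]) (auto simp: assms(2) infinite_UNIV_char_0)

lemma matrix_poly_fun_uminus: "matrix_poly_fun d f \<Longrightarrow> matrix_poly_fun d (\<lambda>z. - f z)"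
  using matrix_poly_fun_lmult[of d f "- 1"] by simp

lemma matrix_poly_fun_sum:
  assumes "finite I" "\<And>i. i \<in> I \<Longrightarrow> matrix_poly_fun d (f i)"
  shows "matrix_poly_fun d (\<lambda>z. \<Sum>i\<in>I. f i z)"
  using assms
proof (induction I rule: finite_induct)
  case empty
  show ?case using matrix_poly_fun_mono[OF matrix_poly_fun.const[of 0]] by simp
qed (simp add: matrix_poly_fun_add)

lemma matrix_poly_fun_power: "matrix_poly_fun d (\<lambda>z. cs (z ^ d) * X)"
proof (induction d)
  case (Suc d)
  show ?case using matrix_poly_fun.horner[OF Suc, of 0] by (simp add: mult.assoc[symmetric])
qed (simp add: matrix_poly_fun.const)

text \<open>The reversed polynomial makes the behaviour of \<open>f\<close> at infinity visible at
  0: its value there is the coefficient of degree \<open>d\<close> of \<open>f\<close>.\<close>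

lemma matrix_poly_fun_reverse:
  assumes "matrix_poly_fun d f"
  obtains g where "matrix_poly_fun d g" "\<And>z. z \<noteq> 0 \<Longrightarrow> g z = cs (z ^ d) * f (inverse z)"
proof -
  have "\<exists>g. matrix_poly_fun d g \<and> (\<forall>z. z \<noteq> 0 \<longrightarrow> g z = cs (z ^ d) * f (inverse z))"
    using assms
  proof (induction rule: matrix_poly_fun.induct)
    case (const X)
    show ?case by (rule exI[of _ "\<lambda>_. X"]) (simp add: matrix_poly_fun.const)
  next
    case (horner d f X)
    then obtain g where g: "matrix_poly_fun d g" "\<And>z. z \<noteq> 0 \<Longrightarrow> g z = cs (z ^ d) * f (inverse z)" by blast
    have "matrix_poly_fun (Suc d) (\<lambda>z. g z + cs (z ^ Suc d) * X)"
      by (intro matrix_poly_fun_add matrix_poly_fun_Suc g(1) matrix_poly_fun_power)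
    moreover have "g z + cs (z ^ Suc d) * X = cs (z ^ Suc d) * (cs (inverse z) * f (inverse z) + X)" if "z \<noteq> 0" for z
    proof -
      have "z ^ Suc d * inverse z = z ^ d" using that by simp
      then show ?thesis using that by (simp add: g(2) distrib_left mult.assoc[symmetric] del: power_Suc)
    qed
    ultimately show ?case by blast
  qed
  then show thesis using that by blast
qed

text \<open>The pair \<open>(p, q)\<close> stands for the affine function \<open>z * p + q\<close>,
  a candidate eigenvalue of the pencil \<open>z A + B\<close>, with \<open>p\<close> belonging to
  \<open>A\<close> and \<open>q\<close> to \<open>B\<close>.\<close>

definition pencil_ev :: "complex \<Rightarrow> complex \<times> complex \<Rightarrow> complex" where
  "pencil_ev z r = z * fst r + snd r"

lemma pencil_diff:
  "cs z * A + B - cs (pencil_ev z r) = cs z * (A - cs (fst r)) + (B - cs (snd r))"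
  by (simp add: pencil_ev_def algebra_simps flip: cs_simps(4,6))

lemma matrix_poly_fun_lprod:
  "\<exists>d. matrix_poly_fun d (\<lambda>z. lprod (map (pencil_ev z) G) (cs z * A + B))"
proof (induction G)
  case Nil
  show ?case by (auto intro: matrix_poly_fun.const)
next
  case (Cons r G)
  then show ?case by (auto simp: pencil_diff intro: matrix_poly_fun_pencil)
qed

lemma matrix_poly_fun_scalar_prod:
  "\<exists>d. matrix_poly_fun d (\<lambda>z. cs (\<Prod>r\<leftarrow>R. pencil_ev z r) :: 'n::finite cmat)"
proof (induction R)
  case Nil
  show ?case by (auto intro: matrix_poly_fun.const)
next
  case (Cons r G)
  then obtain d where "matrix_poly_fun d (\<lambda>z. cs (\<Prod>r\<leftarrow>G. pencil_ev z r) :: 'n cmat)" by blast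
  from matrix_poly_fun_pencil[OF this, of "cs (fst r)" "cs (snd r)"]
  show ?case by (auto simp: pencil_ev_def)
qed

text \<open>For an eigenvector \<open>f i\<close> depending polynomially on the parameter, its value
  and its difference quotient at \<open>c\<close> solve the equations of orders zero and one, so
  first order perturbation theory applies.\<close>

lemma perturbed_pencil_sum_eq_0:
  assumes "finite I" "semisimple M" "inj_on (\<lambda>i. (l i, a i)) I"
    and f: "\<And>i. i \<in> I \<Longrightarrow> matrix_poly_fun d (f i)"
    and eq: "\<And>i u. i \<in> I \<Longrightarrow> ((M - cs (l i)) + cs (u - c) * (A - cs (a i))) * f i u = 0"
    and s: "(\<Sum>i\<in>I. f i c) = 0" and j: "j \<in> I"
  shows "f j c = 0"
proof -
  have "\<exists>Y. (M - cs (l i)) * Y + (A - cs (a i)) * f i c = 0" if i: "i \<in> I" for i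
  proof -
    obtain g where g: "matrix_poly_fun d g" "\<And>z. f i z = f i c + cs (z - c) * g z"
      using matrix_poly_fun_divide[OF matrix_poly_fun_Suc[OF f[OF i]], where c=c] by blast
    \<comment> \<open>Multiplied by \<open>u - c\<close> this becomes the eigenvalue equation, so it
      vanishes for \<open>u\<close> other than \<open>c\<close> and, being a polynomial, also at
      \<open>c\<close>.\<close>
    define h where "h u = (M - cs (l i)) * g u + (A - cs (a i)) * f i u" for u
    have h0: "(M - cs (l i)) * f i c = 0" using eq[OF i, of c] by simp
    have "h u = 0" if "u \<noteq> c" for u
    proof -
      have "cs (u - c) * h u = (M - cs (l i)) * (cs (u - c) * g u) + cs (u - c) * ((A - cs (a i)) * f i u)"
        by (simp only: h_def distrib_left cs_left_commute[of "M - cs (l i)"])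
      also have "cs (u - c) * g u = f i u - f i c" using g(2)[of u] by simp
      also have "(M - cs (l i)) * (f i u - f i c) = (M - cs (l i)) * f i u"
        by (simp add: right_diff_distrib h0)
      also have "\<dots> + cs (u - c) * ((A - cs (a i)) * f i u) = 0"
        using eq[OF i, of u] by (simp add: distrib_right mult.assoc)
      finally show ?thesis using that by (simp add: cs_mult_eq_0_iff)
    qed
    moreover have "matrix_poly_fun d h"
      unfolding h_def by (intro matrix_poly_fun_add matrix_poly_fun_lmult g(1) f i)
    ultimately have "h c = 0" using matrix_poly_fun_eq_0_except by blast
    then show ?thesis unfolding h_def by blast
  qed
  then obtain Y where Y: "\<And>i. i \<in> I \<Longrightarrow> (M - cs (l i)) * Y i + (A - cs (a i)) * f i c = 0" by metis
  show ?thesis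
    by (rule perturbed_eigen_sum_eq_0[OF assms(1-3) _ Y s j]) (use eq[of _ c] in simp_all)
qed

lemma matrix_poly_fun_scalar_poly:
  assumes "matrix_poly_fun d f"
  shows "\<exists>e. matrix_poly_fun e (\<lambda>z. cs (poly p z) * f z)"
proof (induction p)
  case 0
  show ?case by (auto intro: matrix_poly_fun.const)
next
  case (pCons a p)
  then obtain e where "matrix_poly_fun e (\<lambda>z. cs (poly p z) * f z)" by blast
  then have 1: "matrix_poly_fun (Suc e) (\<lambda>z. cs z * (cs (poly p z) * f z) + 0)" by (rule matrix_poly_fun.horner)
  have "matrix_poly_fun (max (Suc e) d) (\<lambda>z. cs a * f z + (cs z * (cs (poly p z) * f z) + 0))"
    by (intro matrix_poly_fun_add matrix_poly_fun_mono[OF 1] matrix_poly_fun_mono[OF matrix_poly_fun_lmult[OF assms]]) auto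
  moreover have "cs (poly (pCons a p) z) * f z = cs a * f z + (cs z * (cs (poly p z) * f z) + 0)" for z
    by (simp add: distrib_right mult.assoc flip: cs_simps(4,6))
  ultimately show ?case by (auto simp del: poly_pCons)
qed

lemma lprod_map_remove1:
  "r \<in> set G \<Longrightarrow> lprod (map v G) M = (M - cs (v r)) * lprod (map v (remove1 r G)) M"
proof (induction G)
  case (Cons a G)
  have "(M - cs (v a)) * (M - cs (v r)) = (M - cs (v r)) * (M - cs (v a))"
    by (simp add: left_diff_distrib right_diff_distrib cs_commute[of M] mult.commute[of "v a" "v r"])
  with Cons show ?case by (auto simp flip: mult.assoc)
qed simp

lemma pencil_ev_diff: "pencil_ev z (r - s) = pencil_ev z r - pencil_ev z s"
  by (simp add: pencil_ev_def algebra_simps)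

text \<open>Lagrange interpolation of the constant 1, with denominators cleared.\<close>

lemma lagrange_pencil:
  assumes "G \<noteq> []" "distinct G"
  shows "\<exists>c R. (\<forall>z. \<forall>M::'n::finite cmat.
      (\<Sum>r\<in>set G. cs (poly (c r) z) * lprod (map (pencil_ev z) (remove1 r G)) M) = cs (\<Prod>r\<leftarrow>R. pencil_ev z r))
    \<and> set R \<subseteq> {r - s | r s. r \<in> set G \<and> s \<in> set G \<and> r \<noteq> s}"
  using assms
proof (induction G rule: list_nonempty_induct)
  case (single x)
  show ?case by (rule exI[of _ "\<lambda>_. 1"], rule exI[of _ "[]"]) simp
next
  case (cons x G)
  then obtain c R where IH: "\<And>z M. (\<Sum>r\<in>set G. cs (poly (c r) z) * lprod (map (pencil_ev z) (remove1 r G)) (M::'n cmat))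
      = cs (\<Prod>r\<leftarrow>R. pencil_ev z r)" and R: "set R \<subseteq> {r - s | r s. r \<in> set G \<and> s \<in> set G \<and> r \<noteq> s}"
    by (auto simp del: cs_simps)
  \<comment> \<open>\<open>P r\<close> times the difference \<open>r - x\<close> is, for every old
    node \<open>r\<close>, the same product over all old nodes. The coefficient of the new node
    subtracts the product of all old factors from each term, which turns the factor for
    \<open>x\<close> into the scalar \<open>r - x\<close>.\<close>
  define P where "P r = (\<Prod>s\<in>set G - {r}. [:snd (s - x), fst (s - x):])" for r
  define c' where "c' r = (if r = x then - (\<Sum>s\<in>set G. c s * P s) else c r * P r)" for r
  define R' where "R' = map (\<lambda>s. s - x) G @ R"
  have x: "x \<notin> set G" and dG: "distinct G" using cons.prems by auto
  have P: "poly (P r) z * pencil_ev z (r - x) = (\<Prod>s\<leftarrow>G. pencil_ev z (s - x))" if "r \<in> set G" for r z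
  proof -
    have "poly (P r) z = (\<Prod>s\<in>set G - {r}. pencil_ev z (s - x))"
      by (simp add: P_def poly_prod pencil_ev_def add.commute)
    then have "poly (P r) z * pencil_ev z (r - x) = (\<Prod>s\<in>set G. pencil_ev z (s - x))"
      using prod.remove[of "set G" r "\<lambda>s. pencil_ev z (s - x)"] that by (simp add: mult.commute)
    then show ?thesis using dG by (simp add: prod.distinct_set_conv_list)
  qed
  have "(\<Sum>r\<in>set (x # G). cs (poly (c' r) z) * lprod (map (pencil_ev z) (remove1 r (x # G))) M)
      = cs (\<Prod>r\<leftarrow>R'. pencil_ev z r)" for z and M :: "'n cmat"
  proof -
    define L where "L r = lprod (map (pencil_ev z) (remove1 r G)) M" for r
    define Q where "Q = lprod (map (pencil_ev z) G) M"
    define D where "D = (\<Prod>s\<leftarrow>G. pencil_ev z (s - x))"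
    have cs_sum: "cs (sum g (set G)) = (\<Sum>r\<in>set G. cs (g r) :: 'n cmat)" for g
      by (rule linear_sum[OF bounded_linear.linear[OF bounded_linear_cs]])
    have "(\<Sum>r\<in>set (x # G). cs (poly (c' r) z) * lprod (map (pencil_ev z) (remove1 r (x # G))) M)
      = cs (poly (c' x) z) * Q
        + (\<Sum>r\<in>set G. cs (poly (c' r) z) * lprod (map (pencil_ev z) (remove1 r (x # G))) M)"
      using x by (simp add: Q_def)
    also have "(\<Sum>r\<in>set G. cs (poly (c' r) z) * lprod (map (pencil_ev z) (remove1 r (x # G))) M)
        = (\<Sum>r\<in>set G. cs (poly (c r) z * poly (P r) z) * ((M - cs (pencil_ev z x)) * L r))"
      using x by (intro sum.cong) (auto simp: L_def c'_def)
    also have "cs (poly (c' x) z) * Q = (\<Sum>r\<in>set G. - (cs (poly (c r) z * poly (P r) z) * Q))"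
      by (simp add: c'_def poly_sum sum_distrib_right sum_negf cs_sum flip: cs_simps(3))
    also have "(\<Sum>r\<in>set G. - (cs (poly (c r) z * poly (P r) z) * Q))
      + (\<Sum>r\<in>set G. cs (poly (c r) z * poly (P r) z) * ((M - cs (pencil_ev z x)) * L r))
      = (\<Sum>r\<in>set G. cs D * (cs (poly (c r) z) * L r))"
      unfolding sum.distrib[symmetric]
    proof (rule sum.cong[OF refl])
      fix r assume r: "r \<in> set G"
      have "Q = (M - cs (pencil_ev z r)) * L r" unfolding Q_def L_def by (rule lprod_map_remove1[OF r])
      then have MQ: "(M - cs (pencil_ev z x)) * L r - Q = cs (pencil_ev z (r - x)) * L r"
        by (simp add: pencil_ev_diff left_diff_distrib flip: cs_simps(5))
      have "- (a * Q) + a * T = a * (T - Q)" for a T by (simp add: right_diff_distrib)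
      then have "- (cs (poly (c r) z * poly (P r) z) * Q) + cs (poly (c r) z * poly (P r) z) * ((M - cs (pencil_ev z x)) * L r)
        = cs (poly (c r) z * poly (P r) z) * (cs (pencil_ev z (r - x)) * L r)"
        by (simp only: MQ)
      also have "\<dots> = cs (poly (c r) z * (poly (P r) z * pencil_ev z (r - x))) * L r"
        by (simp add: mult.assoc flip: cs_simps(6))
      also have "\<dots> = cs D * (cs (poly (c r) z) * L r)"
        by (simp add: P[OF r] D_def[symmetric] mult.assoc[symmetric] mult.commute)
      finally show "- (cs (poly (c r) z * poly (P r) z) * Q) + cs (poly (c r) z * poly (P r) z) * ((M - cs (pencil_ev z x)) * L r)
        = cs D * (cs (poly (c r) z) * L r)" .
    qed
    also have "\<dots> = cs D * cs (\<Prod>r\<leftarrow>R. pencil_ev z r)"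
      using IH[of z M] by (simp only: sum_distrib_left[symmetric] L_def)
    also have "\<dots> = cs (\<Prod>r\<leftarrow>R'. pencil_ev z r)" by (simp add: R'_def D_def o_def)
    finally show ?thesis .
  qed
  moreover have "set R' \<subseteq> {r - s | r s. r \<in> set (x # G) \<and> s \<in> set (x # G) \<and> r \<noteq> s}"
  proof
    fix t assume "t \<in> set R'"
    then have "t \<in> set R \<or> (\<exists>s\<in>set G. t = s - x)" unfolding R'_def set_append set_map by blast
    then show "t \<in> {r - s | r s. r \<in> set (x # G) \<and> s \<in> set (x # G) \<and> r \<noteq> s}"
      using R x unfolding list.set by blast
  qed
  ultimately show ?case by blast
qed

section \<open>Discreteness of the possible eigenvalues and a Bauer--Fike bound\<close>

lemma exp_eq_1_iff_int: "exp m = 1 \<longleftrightarrow> (\<exists>n::int. m = of_int n * (2 * of_real pi * \<i>))"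
  unfolding exp_eq_1 by (auto simp: complex_eq_iff)

lemma finite_exp_eq_1_bounded: "finite {b::complex. exp b = 1 \<and> norm b \<le> C}"
proof (rule finite_subset)
  show "{b::complex. exp b = 1 \<and> norm b \<le> C} \<subseteq> (\<lambda>n::int. of_int n * (2 * of_real pi * \<i>)) ` {- \<lceil>C\<rceil>..\<lceil>C\<rceil>}"
  proof
    fix b :: complex assume "b \<in> {b. exp b = 1 \<and> norm b \<le> C}"
    then obtain n :: int where n: "b = of_int n * (2 * of_real pi * \<i>)" "norm b \<le> C"
      by (auto simp: exp_eq_1_iff_int)
    then have "\<bar>of_int n\<bar> * (2 * pi) \<le> C" by (simp add: norm_mult)
    moreover have "\<bar>of_int n\<bar> * 1 \<le> \<bar>of_int n\<bar> * (2 * pi)"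
      by (rule mult_left_mono) (use pi_ge_two in auto)
    ultimately have "\<bar>real_of_int n\<bar> \<le> C" by simp
    then have "n \<in> {- \<lceil>C\<rceil>..\<lceil>C\<rceil>}" by (auto simp: abs_le_iff) linarith+
    then show "b \<in> (\<lambda>n::int. of_int n * (2 * of_real pi * \<i>)) ` {- \<lceil>C\<rceil>..\<lceil>C\<rceil>}" using n by blast
  qed
qed simp

text \<open>Bauer--Fike argument. The Lagrange projections \<open>E r\<close> of \<open>A\<close>
  turn the eigenvalue equation into \<open>(m - k * a) * (E r * W) = E r * B * W\<close>. If
  \<open>m\<close> were far from every \<open>k * a\<close>, all \<open>E r * W\<close> would be
  small, though they add up to \<open>W\<close>.\<close>

lemma exp_eq_1_perturbed_spectrum_bound:
  fixes A B :: "'n::finite cmat"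
  assumes A: "exp A = 1"
  obtains F C where "finite F" "\<And>a. a \<in> F \<Longrightarrow> exp a = 1"
    "\<And>k m W. (cs k * A + B - cs m) * W = 0 \<Longrightarrow> W \<noteq> 0 \<Longrightarrow> \<exists>a\<in>F. norm (m - k * a) \<le> C"
proof -
  obtain fl where fl: "distinct fl" "fl \<noteq> []" "\<And>m. m \<in> set fl \<Longrightarrow> exp m = 1" "lprod fl A = 0"
    by (rule exp_eq_1_finite_spectrum[OF A]) blast
  \<comment> \<open>At \<open>z = 1\<close> the pairs \<open>(a, 0)\<close> evaluate to the roots
    \<open>a\<close>, so interpolation for pencils covers the single matrix
    \<open>A\<close>.\<close>
  define G where "G = map (\<lambda>a. (a, 0::complex)) fl"
  have "distinct G" "G \<noteq> []" using fl by (auto simp: G_def distinct_map inj_on_def)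
  from lagrange_pencil[OF this(2,1), where 'n='n] obtain c R where
    lag: "\<And>z M. (\<Sum>r\<in>set G. cs (poly (c r) z) * lprod (map (pencil_ev z) (remove1 r G)) (M::'n cmat))
      = cs (\<Prod>r\<leftarrow>R. pencil_ev z r)" and R: "set R \<subseteq> {r - s | r s. r \<in> set G \<and> s \<in> set G \<and> r \<noteq> s}"
    by (auto simp del: cs_simps)
  define D where "D = (\<Prod>r\<leftarrow>R. pencil_ev 1 r)"
  have "0 \<notin> set (map (pencil_ev 1) R)" using R by (auto simp: G_def pencil_ev_def)
  then have D: "D \<noteq> 0" by (simp add: D_def prod_list_zero_iff)
  define E where "E r = cs (inverse D * poly (c r) 1) * lprod (map (pencil_ev 1) (remove1 r G)) A" for r
  have sumE: "(\<Sum>r\<in>set G. E r) = 1"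
  proof -
    have "(\<Sum>r\<in>set G. E r) = cs (inverse D) * (\<Sum>r\<in>set G. cs (poly (c r) 1) * lprod (map (pencil_ev 1) (remove1 r G)) A)"
      unfolding sum_distrib_left E_def by (simp add: mult.assoc flip: cs_simps(6))
    then show ?thesis using D by (simp add: lag D_def[symmetric])
  qed
  have EA: "E r * A = cs (fst r) * E r" if r: "r \<in> set G" for r
  proof -
    have "map (pencil_ev 1) G = fl" by (simp add: G_def pencil_ev_def o_def)
    then have "(A - cs (fst r)) * lprod (map (pencil_ev 1) (remove1 r G)) A = 0"
      using lprod_map_remove1[OF r, of "pencil_ev 1" A] fl(4) r by (auto simp: pencil_ev_def G_def)
    then have "lprod (map (pencil_ev 1) (remove1 r G)) A * (A - cs (fst r)) = 0"
      by (simp add: lprod_commute_self)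
    then have "E r * (A - cs (fst r)) = 0" by (simp add: E_def mult.assoc)
    then show ?thesis by (simp add: right_diff_distrib cs_commute)
  qed
  obtain K where K: "K > 0" "\<And>x. norm (cs x :: 'n cmat) \<le> norm x * K"
    using bounded_linear.pos_bounded[OF bounded_linear_cs[where 'n='n]] by blast
  \<comment> \<open>\<open>K\<close> compares the norm of \<open>cs x\<close> with that of
    \<open>x\<close>. The added 1 makes the final contraction factor \<open>(C - 1) / C\<close> less
    than 1.\<close>
  define C where "C = K * (\<Sum>r\<in>set G. norm (E r)) * norm B + 1"
  have Cpos: "C \<ge> 1" unfolding C_def using K(1) by (simp add: sum_nonneg)
  show thesis
  proof
    show "finite (set fl)" by simp
    show "exp a = 1" if "a \<in> set fl" for a using fl(3) that .
    fix k m W assume W: "(cs k * A + B - cs m) * W = 0" "W \<noteq> 0"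
    show "\<exists>a\<in>set fl. norm (m - k * a) \<le> C"
    proof (rule ccontr)
      assume "\<not> ?thesis"
      then have far: "norm (m - k * fst r) > C" if "r \<in> set G" for r using that by (auto simp: G_def)
      have "norm (E r * W) \<le> K * norm (E r) * norm B / C * norm W" if r: "r \<in> set G" for r
      proof -
        define q where "q = m - k * fst r"
        have q: "norm q > C" "q \<noteq> 0" using far[OF r] Cpos by (auto simp: q_def)
        have "0 = E r * ((cs k * A + B - cs m) * W)" using W by simp
        also have "\<dots> = cs k * (E r * A) * W + E r * B * W - cs m * E r * W"
          by (simp add: distrib_left distrib_right left_diff_distrib right_diff_distrib mult.assoc cs_left_commute[of "E r"])
        also have "\<dots> = E r * B * W - cs q * (E r * W)"
          by (simp add: EA[OF r] q_def left_diff_distrib mult.assoc flip: cs_simps(5,6))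
        finally have "cs q * (E r * W) = E r * B * W" by simp
        then have "E r * W = cs (inverse q) * (E r * B * W)" using q(2) by (metis cs_cancel(1))
        also have "norm \<dots> \<le> norm (cs (inverse q) :: 'n cmat) * norm (E r * B * W)" by (rule norm_mult_ineq)
        also have "\<dots> \<le> (norm (inverse q) * K) * (norm (E r) * norm B * norm W)"
          by (intro mult_mono K order_trans[OF norm_mult_ineq] mult_right_mono norm_mult_ineq) (use K in auto)
        also have "\<dots> \<le> (inverse C * K) * (norm (E r) * norm B * norm W)"
          using q(1) Cpos K(1) by (intro mult_right_mono) (auto simp: norm_inverse intro!: le_imp_inverse_le)
        finally show ?thesis by (simp add: field_simps)
      qed
      then have "norm (\<Sum>r\<in>set G. E r * W) \<le> (\<Sum>r\<in>set G. K * norm (E r) * norm B / C * norm W)"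
        by (rule sum_norm_le)
      also have "\<dots> = (C - 1) / C * norm W"
        by (simp add: C_def sum_distrib_left sum_distrib_right sum_divide_distrib)
      finally have "norm W \<le> (C - 1) / C * norm W"
        using sumE by (simp add: sum_distrib_right[symmetric])
      then have "norm W \<le> 0" using Cpos by (simp add: field_simps)
      then show False using W(2) by simp
    qed
  qed
qed

section \<open>Pencils with trivial exponential on the lattice\<close>

text \<open>For integer \<open>k\<close>, an eigenvalue \<open>m\<close> of \<open>k A + B\<close>
  and the number \<open>k * a\<close> both lie in \<open>2 \<pi> i \<int>\<close>, so
  \<open>m - k * a\<close> is one of finitely many bounded elements \<open>b\<close> of that
  lattice, and \<open>G\<close> collects all pairs \<open>(a, b)\<close>. The product vanishes at
  all integers, hence identically.\<close>

lemma pencil_joint_spectrum: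
  fixes A B :: "'n::finite cmat"
  assumes h: "\<And>k l::int. exp (cs (of_int k) * A + cs (of_int l) * B) = 1"
  obtains G where "distinct G" "\<And>r. r \<in> set G \<Longrightarrow> exp (fst r) = 1 \<and> exp (snd r) = 1"
    "\<And>z. lprod (map (pencil_ev z) G) (cs z * A + B) = 0"
proof -
  have "exp A = 1" using h[of 1 0] by simp
  from exp_eq_1_perturbed_spectrum_bound[OF this, of B] obtain F C where
    F: "finite F" "\<And>a. a \<in> F \<Longrightarrow> exp a = 1"
    "\<And>k m W. (cs k * A + B - cs m) * W = 0 \<Longrightarrow> W \<noteq> 0 \<Longrightarrow> \<exists>a\<in>F. norm (m - k * a) \<le> C" by blast
  have "finite (F \<times> {b::complex. exp b = 1 \<and> norm b \<le> C})"
    by (intro finite_cartesian_product F finite_exp_eq_1_bounded)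
  then obtain G where G: "set G = F \<times> {b::complex. exp b = 1 \<and> norm b \<le> C}" "distinct G"
    using finite_distinct_list by blast
  have int: "lprod (map (pencil_ev (of_int k)) G) (cs (of_int k) * A + B) = 0" for k :: int
  proof (rule exp_eq_1_lprod_eq_0)
    show M: "exp (cs (of_int k) * A + B) = 1" using h[of k 1] by simp
    fix m W assume W: "(cs (of_int k) * A + B - cs m) * W = 0" "W \<noteq> 0"
    then obtain a where a: "a \<in> F" "norm (m - of_int k * a) \<le> C" using F(3) by blast
    have "exp m = 1" by (rule exp_eq_1_eigenvalue[OF M W])
    moreover have "exp (of_int k * a) = 1"
    proof -
      obtain n :: int where "a = of_int n * (2 * of_real pi * \<i>)"
        using F(2)[OF a(1)] by (auto simp: exp_eq_1_iff_int)
      then have "of_int k * a = of_int (k * n) * (2 * of_real pi * \<i>)" by simp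
      then show ?thesis unfolding exp_eq_1_iff_int by blast
    qed
    ultimately have "exp (m - of_int k * a) = 1" by (simp add: exp_diff)
    then have "(a, m - of_int k * a) \<in> set G" using a G by simp
    moreover have "pencil_ev (of_int k) (a, m - of_int k * a) = m" by (simp add: pencil_ev_def)
    ultimately show "m \<in> set (map (pencil_ev (of_int k)) G)" by (metis image_eqI set_map)
  qed
  have "lprod (map (pencil_ev z) G) (cs z * A + B) = 0" for z
  proof -
    obtain d where "matrix_poly_fun d (\<lambda>z. lprod (map (pencil_ev z) G) (cs z * A + B))"
      using matrix_poly_fun_lprod by blast
    moreover have "infinite (range (of_int :: int \<Rightarrow> complex))"
      by (metis finite_imageD infinite_UNIV_int injI of_int_eq_iff)
    ultimately show ?thesis
      by (rule matrix_poly_fun_eq_0) (use int in auto)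
  qed
  then show thesis using that[of G] G F(2) by auto
qed

text \<open>The linear factors of the sum are removed one at a time. Each nonconstant one vanishes
  at a rational point \<open>c\<close>, where the pencil is semisimple; there the \<open>f r\<close>
  sum to 0, so every \<open>f r\<close> vanishes and \<open>z - c\<close> divides it.\<close>

lemma pencil_remove_denominators:
  fixes A B :: "'n::finite cmat" and f :: "complex \<times> complex \<Rightarrow> complex \<Rightarrow> 'n cmat"
  assumes h: "\<And>k l::int. exp (cs (of_int k) * A + cs (of_int l) * B) = 1"
    and "finite G"
    and "\<And>r. r \<in> G \<Longrightarrow> matrix_poly_fun d (f r)"
    and "\<And>r z. r \<in> G \<Longrightarrow> (cs z * A + B - cs (pencil_ev z r)) * f r z = 0"
    and "\<And>z. (\<Sum>r\<in>G. f r z) = cs (\<Prod>r\<leftarrow>R. pencil_ev z r)"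
    and "\<And>r. r \<in> set R \<Longrightarrow> exp (fst r) = 1 \<and> exp (snd r) = 1 \<and> r \<noteq> 0"
  shows "\<exists>f d. (\<forall>r\<in>G. matrix_poly_fun d (f r) \<and> (\<forall>z. (cs z * A + B - cs (pencil_ev z r)) * f r z = 0))
     \<and> (\<forall>z. (\<Sum>r\<in>G. f r z) = 1)"
  using assms(3-)
proof (induction R arbitrary: f d)
  case Nil
  then show ?case by (intro exI[of _ f] exI[of _ d]) auto
next
  case (Cons s R)
  define p q where "p = fst s" and "q = snd s"
  have s: "exp p = 1" "exp q = 1" "p \<noteq> 0 \<or> q \<noteq> 0"
    using Cons.prems(4)[of s] by (auto simp: p_def q_def zero_prod_def prod_eq_iff)
  have R: "\<And>r. r \<in> set R \<Longrightarrow> exp (fst r) = 1 \<and> exp (snd r) = 1 \<and> r \<noteq> 0"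
    using Cons.prems(4) by simp
  have sum: "(\<Sum>r\<in>G. f r z) = cs (pencil_ev z s) * cs (\<Prod>r\<leftarrow>R. pencil_ev z r)" for z
    using Cons.prems(3)[of z] by simp
  show ?case
  proof (cases "p = 0")
    case True
    then have q: "q \<noteq> 0" "\<And>z. pencil_ev z s = q" using s by (auto simp: pencil_ev_def p_def q_def)
    show ?thesis
    proof (rule Cons.IH[OF _ _ _ R])
      show "matrix_poly_fun d (\<lambda>z. cs (inverse q) * f r z)" if "r \<in> G" for r
        by (intro matrix_poly_fun_lmult Cons.prems(1) that)
      show "(cs z * A + B - cs (pencil_ev z r)) * (cs (inverse q) * f r z) = 0" if "r \<in> G" for r z
        using Cons.prems(2)[OF that] by (simp add: cs_left_commute[of "cs z * A + B - cs (pencil_ev z r)"])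
      show "(\<Sum>r\<in>G. cs (inverse q) * f r z) = cs (\<Prod>r\<leftarrow>R. pencil_ev z r)" for z
        using sum[of z] by (simp only: sum_distrib_left[symmetric] q(2) cs_cancel(1)[OF q(1)])
    qed
  next
    case False
    define c where "c = - q / p"
    have ev: "pencil_ev z s = p * (z - c)" for z
      using False by (simp add: pencil_ev_def p_def q_def c_def field_simps)
    \<comment> \<open>\<open>c = - n / m\<close> is rational, so \<open>m\<close> times the pencil
      at \<open>c\<close> is the lattice element \<open>- n A + m B\<close>, whose exponential is
      1.\<close>
    obtain m n :: int where mn: "p = of_int m * (2 * of_real pi * \<i>)" "q = of_int n * (2 * of_real pi * \<i>)"
      using s by (auto simp: exp_eq_1_iff_int)
    have m: "m \<noteq> 0" using False mn by auto
    have c: "c = - of_int n / of_int m" using False by (simp add: c_def mn)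
    have ss: "semisimple (cs c * A + B)"
    proof (rule semisimple_scale)
      have "cs (of_int m) * (cs c * A + B) = cs (of_int (- n)) * A + cs (of_int m) * B"
        using m by (simp add: c distrib_left mult.assoc[symmetric])
      then have "exp (cs (of_int m) * (cs c * A + B)) = 1" by (simp only: h)
      then show "semisimple (cs (of_int m) * (cs c * A + B))" by (rule exp_eq_1_semisimple)
      show "(of_int m :: complex) \<noteq> 0" using m by simp
    qed
    have shift: "cs z * A + B - cs (pencil_ev z r)
        = (cs c * A + B - cs (pencil_ev c r)) + cs (z - c) * (A - cs (fst r))" for z r
      by (simp add: pencil_diff left_diff_distrib flip: cs_simps(5))
    have f0: "f r c = 0" if r: "r \<in> G" for r
    proof (rule perturbed_pencil_sum_eq_0[OF \<open>finite G\<close> ss _ Cons.prems(1) _ _ r])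
      \<comment> \<open>An affine function is determined by its value at \<open>c\<close> and its
        slope.\<close>
      show "inj_on (\<lambda>r. (pencil_ev c r, fst r)) G"
        by (auto simp: inj_on_def pencil_ev_def prod_eq_iff)
      show "(cs c * A + B - cs (pencil_ev c i) + cs (u - c) * (A - cs (fst i))) * f i u = 0" if "i \<in> G" for i u
        using Cons.prems(2)[OF that, of u] by (simp only: shift[of u i])
      show "(\<Sum>r\<in>G. f r c) = 0" using sum[of c] by (simp add: ev)
    qed
    have "\<exists>g. matrix_poly_fun d g \<and> (\<forall>z. f r z = cs (z - c) * g z)" if r: "r \<in> G" for r
      using matrix_poly_fun_divide[OF matrix_poly_fun_Suc[OF Cons.prems(1)[OF r]], where c=c] f0[OF r]
      by (metis add_0)
    then obtain g where g: "\<And>r. r \<in> G \<Longrightarrow> matrix_poly_fun d (g r)" "\<And>r z. r \<in> G \<Longrightarrow> f r z = cs (z - c) * g r z"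
      by metis
    show ?thesis
    proof (rule Cons.IH[OF _ _ _ R])
      show "matrix_poly_fun d (\<lambda>z. cs (inverse p) * g r z)" if "r \<in> G" for r
        by (intro matrix_poly_fun_lmult g that)
      have "(cs z * A + B - cs (pencil_ev z r)) * g r z = 0" if r: "r \<in> G" for r z
      proof (rule matrix_poly_fun_eq_0_except)
        show "matrix_poly_fun (Suc d) (\<lambda>z. (cs z * A + B - cs (pencil_ev z r)) * g r z)"
          unfolding pencil_diff by (intro matrix_poly_fun_pencil g r)
        show "(cs z * A + B - cs (pencil_ev z r)) * g r z = 0" if "z \<noteq> c" for z
          using Cons.prems(2)[OF r, of z] that
          by (simp add: g(2)[OF r] cs_left_commute[of "cs z * A + B - cs (pencil_ev z r)"] cs_mult_eq_0_iff)
      qed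
      then show "(cs z * A + B - cs (pencil_ev z r)) * (cs (inverse p) * g r z) = 0" if "r \<in> G" for r z
        using that by (simp add: cs_left_commute[of "cs z * A + B - cs (pencil_ev z r)"])
      obtain e where e: "matrix_poly_fun e (\<lambda>z. cs (\<Prod>r\<leftarrow>R. pencil_ev z r) :: 'n cmat)"
        using matrix_poly_fun_scalar_prod by blast
      have "(\<Sum>r\<in>G. cs (inverse p) * g r z) + - cs (\<Prod>r\<leftarrow>R. pencil_ev z r) = 0" for z
      proof (rule matrix_poly_fun_eq_0_except[where c=c
            and f="\<lambda>z. (\<Sum>r\<in>G. cs (inverse p) * g r z) + - cs (\<Prod>r\<leftarrow>R. pencil_ev z r)"])
        show "matrix_poly_fun (max d e) (\<lambda>z. (\<Sum>r\<in>G. cs (inverse p) * g r z) + - cs (\<Prod>r\<leftarrow>R. pencil_ev z r))"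
          by (intro matrix_poly_fun_add matrix_poly_fun_uminus matrix_poly_fun_mono[OF e]
              matrix_poly_fun_mono[OF matrix_poly_fun_sum[OF \<open>finite G\<close> matrix_poly_fun_lmult[OF g(1)]]]) auto
        show "(\<Sum>r\<in>G. cs (inverse p) * g r z) + - cs (\<Prod>r\<leftarrow>R. pencil_ev z r) = 0" if "z \<noteq> c" for z
        proof -
          have "cs (z - c) * (\<Sum>r\<in>G. g r z) = cs (z - c) * (cs p * cs (\<Prod>r\<leftarrow>R. pencil_ev z r))"
            using sum[of z] by (simp add: g(2) sum_distrib_left ev mult_ac)
          then have "(\<Sum>r\<in>G. g r z) = cs p * cs (\<Prod>r\<leftarrow>R. pencil_ev z r)"
            using that by (metis cs_cancel(1) right_minus_eq)
          then have "(\<Sum>r\<in>G. cs (inverse p) * g r z) = cs (\<Prod>r\<leftarrow>R. pencil_ev z r)"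
            by (simp only: sum_distrib_left[symmetric] cs_cancel(1)[OF False])
          then show ?thesis by simp
        qed
      qed
      then show "(\<Sum>r\<in>G. cs (inverse p) * g r z) = cs (\<Prod>r\<leftarrow>R. pencil_ev z r)" for z
        by (simp only: add_eq_0_iff2 minus_minus)
    qed
  qed
qed

text \<open>Reversal moves infinity to 0: the reversed \<open>g r\<close> are eigenvectors of
  \<open>A + z B\<close> and sum to a positive power of \<open>z\<close>. As \<open>A\<close> is
  semisimple, perturbation theory at 0 makes all leading coefficients \<open>g r 0\<close> vanish,
  and the degree bound drops by one.\<close>

lemma pencil_projections_degree_0:
  fixes A B :: "'n::finite cmat" and f :: "complex \<times> complex \<Rightarrow> complex \<Rightarrow> 'n cmat"
  assumes "semisimple A" "finite G"
    and "\<And>r. r \<in> G \<Longrightarrow> matrix_poly_fun d (f r)"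
    and eq: "\<And>r z. r \<in> G \<Longrightarrow> (cs z * A + B - cs (pencil_ev z r)) * f r z = 0"
    and sum: "\<And>z. (\<Sum>r\<in>G. f r z) = 1"
    and "r \<in> G"
  shows "matrix_poly_fun 0 (f r)"
  using assms(3,6)
proof (induction d arbitrary: r)
  case (Suc d)
  have "\<exists>g. matrix_poly_fun (Suc d) g \<and> (\<forall>z. z \<noteq> 0 \<longrightarrow> g z = cs (z ^ Suc d) * f r (inverse z))" if "r \<in> G" for r
    using matrix_poly_fun_reverse[OF Suc.prems(1)[OF that]] by blast
  then obtain g where g: "\<And>r. r \<in> G \<Longrightarrow> matrix_poly_fun (Suc d) (g r)"
    "\<And>r z. r \<in> G \<Longrightarrow> z \<noteq> 0 \<Longrightarrow> g r z = cs (z ^ Suc d) * f r (inverse z)" by metis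
  have geq: "(A - cs (fst r) + cs z * (B - cs (snd r))) * g r z = 0" if r: "r \<in> G" for r z
  proof (rule matrix_poly_fun_eq_0_except)
    show "matrix_poly_fun (Suc (Suc d)) (\<lambda>z. (A - cs (fst r) + cs z * (B - cs (snd r))) * g r z)"
      using matrix_poly_fun_pencil[OF g(1)[OF r], of "B - cs (snd r)" "A - cs (fst r)"]
      by (simp only: add.commute)
    show "(A - cs (fst r) + cs z * (B - cs (snd r))) * g r z = 0" if z: "z \<noteq> 0" for z
    proof -
      define T where "T = A - cs (fst r) + cs z * (B - cs (snd r))"
      have "T = cs z * (cs (inverse z) * A + B - cs (pencil_ev (inverse z) r))"
        using z by (simp add: T_def pencil_diff distrib_left cs_cancel)
      then have "T * f r (inverse z) = 0" using eq[OF r, of "inverse z"] by (simp add: mult.assoc)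
      then have "T * g r z = 0" by (simp add: g(2)[OF r z] cs_left_commute[of T] del: power_Suc)
      then show ?thesis by (simp only: T_def)
    qed
  qed
  have gsum: "(\<Sum>r\<in>G. g r z) + - (cs (z ^ Suc d) * 1) = 0" for z
  proof (rule matrix_poly_fun_eq_0_except[where c=0
        and f="\<lambda>z. (\<Sum>r\<in>G. g r z) + - (cs (z ^ Suc d) * 1)"])
    show "matrix_poly_fun (Suc d) (\<lambda>z. (\<Sum>r\<in>G. g r z) + - (cs (z ^ Suc d) * 1))"
      by (intro matrix_poly_fun_add matrix_poly_fun_uminus matrix_poly_fun_power matrix_poly_fun_sum assms(2) g(1))
    show "(\<Sum>r\<in>G. g r z) + - (cs (z ^ Suc d) * 1) = 0" if z: "z \<noteq> 0" for z
      using z sum[of "inverse z"] by (simp add: g(2) sum_distrib_left[symmetric] del: power_Suc)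
  qed
  have g0: "g r 0 = 0" if r: "r \<in> G" for r
  proof (rule perturbed_pencil_sum_eq_0[OF assms(2) assms(1) _ g(1) _ _ r])
    show "inj_on (\<lambda>r. (fst r, snd r)) G" by (simp add: inj_on_def)
    show "(A - cs (fst i) + cs (u - 0) * (B - cs (snd i))) * g i u = 0" if "i \<in> G" for i u
      using geq[OF that] by simp
    show "(\<Sum>r\<in>G. g r 0) = 0" using gsum[of 0] by simp
  qed
  have "matrix_poly_fun d (f r)" if r: "r \<in> G" for r
  proof -
    obtain k where k: "matrix_poly_fun d k" "\<And>z. g r z = g r 0 + cs (z - 0) * k z"
      using matrix_poly_fun_divide[OF g(1)[OF r], where c=0] by blast
    \<comment> \<open>Reversing \<open>g r z / z\<close> with bound \<open>d\<close> gives back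
      \<open>f r\<close>, now with the smaller degree bound.\<close>
    obtain k' where k': "matrix_poly_fun d k'" "\<And>z. z \<noteq> 0 \<Longrightarrow> k' z = cs (z ^ d) * k (inverse z)"
      using matrix_poly_fun_reverse[OF k(1)] by blast
    have "f r z + - k' z = 0" for z
    proof (rule matrix_poly_fun_eq_0_except)
      show "matrix_poly_fun (Suc d) (\<lambda>z. f r z + - k' z)"
        by (intro matrix_poly_fun_add matrix_poly_fun_uminus matrix_poly_fun_Suc[OF k'(1)] Suc.prems(1) r)
      show "f r z + - k' z = 0" if z: "z \<noteq> 0" for z
      proof -
        have "cs (inverse z) * k (inverse z) = cs (inverse z ^ Suc d) * f r z"
          using k(2)[of "inverse z"] g(2)[OF r, of "inverse z"] g0[OF r] z by simp
        then have "cs (z ^ Suc d) * (cs (inverse z) * k (inverse z)) = cs (z ^ Suc d) * (cs (inverse z ^ Suc d) * f r z)"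
          by simp
        moreover have "z ^ Suc d * inverse z ^ Suc d = 1" "z ^ Suc d * inverse z = z ^ d"
          using z by (simp_all add: power_mult_distrib[symmetric] del: power_Suc) simp
        ultimately have "cs (z ^ d) * k (inverse z) = f r z"
          by (simp add: mult.assoc[symmetric] del: power_Suc)
        then show ?thesis using k'(2)[OF z] by simp
      qed
    qed
    then have "f r = k'" by (simp add: fun_eq_iff)
    then show ?thesis using k'(1) by simp
  qed
  then show ?case using Suc.IH Suc.prems(2) by blast
qed simp

text \<open>A Motzkin--Taussky theorem: the pencil has affine eigenvalues and all its rational members,
  including the one at infinity, are semisimple; hence its eigenprojections have no poles.\<close>

lemma exp_lattice_eq_1_commute:
  fixes A B :: "'n::finite cmat"
  assumes h: "\<And>k l::int. exp (cs (of_int k) * A + cs (of_int l) * B) = 1"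
  shows "A * B = B * A"
proof -
  obtain G where G: "distinct G" "\<And>r. r \<in> set G \<Longrightarrow> exp (fst r) = 1 \<and> exp (snd r) = 1"
    "\<And>z. lprod (map (pencil_ev z) G) (cs z * A + B) = 0"
    by (rule pencil_joint_spectrum[OF h]) blast
  have "G \<noteq> []" using G(3)[of 0] by auto
  from lagrange_pencil[OF this G(1), where 'n='n] obtain c R where
    lag: "\<And>z M. (\<Sum>r\<in>set G. cs (poly (c r) z) * lprod (map (pencil_ev z) (remove1 r G)) (M::'n cmat))
      = cs (\<Prod>r\<leftarrow>R. pencil_ev z r)" and R: "set R \<subseteq> {r - s | r s. r \<in> set G \<and> s \<in> set G \<and> r \<noteq> s}"
    by (auto simp del: cs_simps)
  \<comment> \<open>Unnormalized eigenprojections: each is annihilated by the pencil minus its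
    eigenvalue, and they sum to a product of differences of the affine eigenvalues.\<close>
  define f where "f r z = cs (poly (c r) z) * lprod (map (pencil_ev z) (remove1 r G)) (cs z * A + B)" for r z
  have "\<exists>d. matrix_poly_fun d (f r)" for r
  proof -
    obtain d where "matrix_poly_fun d (\<lambda>z. lprod (map (pencil_ev z) (remove1 r G)) (cs z * A + B))"
      using matrix_poly_fun_lprod by blast
    from matrix_poly_fun_scalar_poly[OF this] show ?thesis unfolding f_def .
  qed
  then obtain d where d: "\<And>r. matrix_poly_fun (d r) (f r)" by metis
  have 1: "matrix_poly_fun (Max (d ` set G)) (f r)" if "r \<in> set G" for r
    by (rule matrix_poly_fun_mono[OF d]) (use that in simp)
  have 2: "(cs z * A + B - cs (pencil_ev z r)) * f r z = 0" if "r \<in> set G" for r z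
    using lprod_map_remove1[OF that, of "pencil_ev z" "cs z * A + B"] G(3)[of z]
    by (simp add: f_def cs_left_commute[of "cs z * A + B - cs (pencil_ev z r)"])
  have 3: "(\<Sum>r\<in>set G. f r z) = cs (\<Prod>r\<leftarrow>R. pencil_ev z r)" for z
    unfolding f_def by (rule lag)
  have 4: "exp (fst t) = 1 \<and> exp (snd t) = 1 \<and> t \<noteq> 0" if "t \<in> set R" for t
  proof -
    obtain r s where "t = r - s" "r \<in> set G" "s \<in> set G" "r \<noteq> s" using R \<open>t \<in> set R\<close> by blast
    then show ?thesis using G(2)[of r] G(2)[of s] by (simp add: exp_diff)
  qed
  have "\<exists>f d. (\<forall>r\<in>set G. matrix_poly_fun d (f r) \<and> (\<forall>z. (cs z * A + B - cs (pencil_ev z r)) * f r z = 0))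
     \<and> (\<forall>z. (\<Sum>r\<in>set G. f r z) = 1)"
    by (rule pencil_remove_denominators[OF h finite_set 1 2 3 4])
  then obtain f d where f: "\<And>r. r \<in> set G \<Longrightarrow> matrix_poly_fun d (f r)"
    "\<And>r z. r \<in> set G \<Longrightarrow> (cs z * A + B - cs (pencil_ev z r)) * f r z = 0"
    "\<And>z. (\<Sum>r\<in>set G. f r z) = 1" by blast
  have "semisimple A" using h[of 1 0] by (intro exp_eq_1_semisimple) simp
  then have const: "matrix_poly_fun 0 (f r)" if "r \<in> set G" for r
    using pencil_projections_degree_0[OF _ finite_set f that] by blast
  \<comment> \<open>The constant value of \<open>f r\<close>. The eigenvalue equation at
    \<open>z = 0\<close> and \<open>z = 1\<close> makes both \<open>B\<close> and \<open>A\<close>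
    act on it as scalars, so \<open>A\<close> and \<open>B\<close> commute on each
    \<open>P r\<close>, and these sum to 1.\<close>
  define P where "P r = f r 0" for r
  have fP: "f r z = P r" if "r \<in> set G" for r z
    using const[OF that] by (cases rule: matrix_poly_fun.cases) (auto simp: P_def)
  have BP: "B * P r = cs (snd r) * P r" if "r \<in> set G" for r
    using f(2)[OF that, of 0] by (simp add: fP[OF that] pencil_ev_def left_diff_distrib)
  have AP: "A * P r = cs (fst r) * P r" if "r \<in> set G" for r
    using f(2)[OF that, of 1] BP[OF that]
    by (simp add: fP[OF that] pencil_ev_def left_diff_distrib distrib_right flip: cs_simps(4))
  have "A * B * P r = B * A * P r" if "r \<in> set G" for r
  proof -
    have "A * B * P r = cs (snd r) * (A * P r)" by (simp add: mult.assoc BP[OF that] cs_left_commute[of A])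
    also have "\<dots> = cs (fst r) * (B * P r)"
      by (simp add: AP[OF that] BP[OF that] mult.assoc[symmetric] mult.commute)
    also have "\<dots> = B * A * P r" by (simp add: mult.assoc AP[OF that] cs_left_commute[of B])
    finally show ?thesis .
  qed
  then have "A * B * (\<Sum>r\<in>set G. P r) = B * A * (\<Sum>r\<in>set G. P r)" by (simp add: sum_distrib_left)
  moreover have "(\<Sum>r\<in>set G. P r) = 1" using f(3)[of 0] by (simp add: P_def)
  ultimately show ?thesis by simp
qed

section \<open>Reduction to trivial exponentials\<close>

lemma exp_int_scaleR_eq_1:
  fixes S :: "'a::{real_normed_algebra_1,banach}"
  assumes "exp S = 1"
  shows "exp (of_int k *\<^sub>R S) = 1"
proof -
  have nat: "exp (real n *\<^sub>R S) = 1" for n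
  proof (induction n)
    case (Suc n)
    have "exp (real n *\<^sub>R S + S) = exp (real n *\<^sub>R S) * exp S" by (rule exp_add_commuting) simp
    then show ?case using Suc assms by (simp add: algebra_simps)
  qed simp
  have "exp (- (real n *\<^sub>R S)) = 1" for n
    using exp_minus_inverse[of "real n *\<^sub>R S"] nat[of n] by simp
  then show ?thesis using nat by (cases k rule: int_cases2) auto
qed

text \<open>The commutator of \<open>V\<close> and \<open>A\<close> commutes with \<open>V\<close>,
  hence with \<open>Y\<close>. Since \<open>V\<close> and \<open>Y\<close> commute, the Jacobi
  identity then shows that the commutator of \<open>Y\<close> and \<open>A\<close> commutes with
  \<open>V\<close>, hence with \<open>Y\<close>.\<close>

lemma double_commutant_second_commutator:
  fixes A Y V :: "'a::ring"
  assumes Y: "\<And>W. W * V = V * W \<Longrightarrow> W * Y = Y * W"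
    and V: "V * (V * A - A * V) = (V * A - A * V) * V"
  shows "Y * (Y * A - A * Y) = (Y * A - A * Y) * Y"
proof -
  have VY: "V * Y = Y * V" by (rule Y) simp
  have D: "(V * A - A * V) * Y = Y * (V * A - A * V)" by (rule Y) (rule V[symmetric])
  have e1: "Y * A * V = Y * (A * V)" "A * Y * V = A * V * Y" "V * (Y * A) = Y * (V * A)" "V * (A * Y) = V * A * Y"
    by (simp_all add: mult.assoc VY) (simp add: mult.assoc[symmetric] VY)
  have "(Y * A - A * Y) * V = V * (Y * A - A * Y)"
    using D by (simp add: left_diff_distrib right_diff_distrib e1) (simp add: algebra_simps)
  from Y[OF this] show ?thesis by simp
qed

text \<open>Moving \<open>A\<close> and \<open>B\<close> to the left past \<open>U * (V * V)\<close>
  leaves the terms \<open>(a * V + V * a) * (V * U)\<close> and \<open>b * (V * (V * U))\<close>.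
  With weights 1 and 2 and \<open>b = - a\<close> their sum is
  \<open>(V * a - a * V) * (V * U)\<close>, which must vanish.\<close>

lemma conjugation_defect_commutes:
  fixes A B U V :: "'a::real_algebra_1"
  assumes UV: "U * V = V * U" and UA: "U * A = A * U" and VB: "V * B = B * V"
    and VA: "V * A = (A + a) * V" and UB: "U * B = (B + b) * U" and ab: "a + b = 0"
    and *: "U * (V * V) * (A + 2 *\<^sub>R B) = (A + 2 *\<^sub>R B) * (U * (V * V))"
    and inv: "V * U * W = 1"
  shows "V * a = a * V"
proof -
  have UVV: "U * (V * V) = V * (V * U)" by (simp add: mult.assoc[symmetric] UV) (simp add: mult.assoc UV)
  have "V * (V * A) = V * ((A + a) * V)" by (simp only: VA)
  also have "\<dots> = V * A * V + V * a * V" by (simp only: distrib_left distrib_right mult.assoc)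
  also have "\<dots> = A * V * V + a * V * V + V * a * V" by (simp only: VA distrib_right)
  finally have VVA: "V * (V * A) = A * V * V + a * V * V + V * a * V" .
  have "U * (V * V) * A = V * (V * A) * U" unfolding UVV by (simp only: mult.assoc UA)
  also have "\<dots> = A * (U * (V * V)) + (a * V + V * a) * (V * U)"
    unfolding VVA UVV by (simp only: distrib_right mult.assoc add.assoc)
  finally have 1: "U * (V * V) * A = A * (U * (V * V)) + (a * V + V * a) * (V * U)" .
  have "U * (V * V) * B = U * B * (V * V)" by (metis VB mult.assoc)
  also have "\<dots> = B * (U * (V * V)) + b * (U * (V * V))" by (simp only: UB distrib_right mult.assoc)
  finally have 2: "U * (V * V) * B = B * (U * (V * V)) + b * (V * (V * U))" by (simp only: UVV)
  have "U * (V * V) * A + 2 *\<^sub>R (U * (V * V) * B) = A * (U * (V * V)) + 2 *\<^sub>R (B * (U * (V * V)))"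
    using * by (simp add: distrib_left distrib_right)
  then have "(a * V + V * a) * (V * U) + 2 *\<^sub>R (b * (V * (V * U))) = 0"
    unfolding 1 2 by (simp add: scaleR_right_distrib)
  moreover have "b = - a" using ab by (simp add: add_eq_0_iff)
  ultimately have "(V * a - a * V) * (V * U) = 0"
    by (simp add: left_diff_distrib distrib_right mult.assoc scaleR_2)
  then have "(V * a - a * V) * (V * U * W) = 0" by (simp add: mult.assoc[symmetric])
  then show ?thesis by (simp add: inv)
qed

lemma exp_commute_of_lattice:
  fixes A B :: "'n::finite cmat"
  assumes H: "\<And>k l::int. exp (of_int k *\<^sub>R A + of_int l *\<^sub>R B) = exp (of_int k *\<^sub>R A) * exp (of_int l *\<^sub>R B)"
  shows "A * B = B * A"
proof -
  define U V U' V' where "U = exp A" and "V = exp B" and "U' = exp (- A)" and "V' = exp (- B)"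
  have inv: "U * U' = 1" "U' * U = 1" "V * V' = 1" "V' * V = 1"
    using exp_minus_inverse[of A] exp_minus_inverse[of "- A"] exp_minus_inverse[of B] exp_minus_inverse[of "- B"]
    by (simp_all add: U_def V_def U'_def V'_def)
  have canc: "U * (U' * Z) = Z" "U' * (U * Z) = Z" "V * (V' * Z) = Z" "V' * (V * Z) = Z" for Z
    by (simp_all add: mult.assoc[symmetric] inv)
  have UA: "U * A = A * U" unfolding U_def by (rule exp_times_arg_commute)
  have VB: "V * B = B * V" unfolding V_def by (rule exp_times_arg_commute)
  \<comment> \<open>\<open>U' * V'\<close> is inverse to \<open>U * V\<close> by the hypothesis at
    \<open>(1, 1)\<close> and \<open>(-1, -1)\<close>, and it is inverse to \<open>V * U\<close> by
    construction.\<close>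
  have UV: "U * V = V * U"
  proof -
    have "exp (A + B) * exp (- (A + B)) = 1" by (rule exp_minus_inverse)
    moreover have "exp (A + B) = U * V" using H[of 1 1] by (simp add: U_def V_def)
    moreover have "exp (- (A + B)) = U' * V'" using H[of "-1" "-1"] by (simp add: U'_def V'_def)
    ultimately have "U * V * (U' * V') * (V * U) = V * U" by simp
    then show ?thesis by (simp add: mult.assoc canc inv)
  qed
  have comm: "exp (of_int k *\<^sub>R A) * exp (of_int l *\<^sub>R B) * (of_int k *\<^sub>R A + of_int l *\<^sub>R B)
      = (of_int k *\<^sub>R A + of_int l *\<^sub>R B) * (exp (of_int k *\<^sub>R A) * exp (of_int l *\<^sub>R B))" for k l :: int
    using exp_times_arg_commute[of "of_int k *\<^sub>R A + of_int l *\<^sub>R B"] by (simp only: H)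
  have two: "exp (2 *\<^sub>R Z) = exp Z * exp Z" for Z :: "'n cmat"
    using exp_add_commuting[of Z Z] by (simp add: scaleR_2)
  define a b where "a = V * A * V' - A" and "b = U * B * U' - B"
  have VA: "V * A = (A + a) * V" by (simp add: a_def mult.assoc inv)
  have UB: "U * B = (B + b) * U" by (simp add: b_def mult.assoc inv)
  have ab: "a + b = 0"
  proof -
    have "U * V * (A + B) = (A + B) * (U * V)" using comm[of 1 1] by (simp add: U_def V_def)
    moreover have "U * V * A = V * A * U" by (simp add: UV mult.assoc UA)
    moreover have "U * V * B = U * B * V" by (simp add: mult.assoc VB)
    ultimately have "V * A * U + U * B * V = (A + B) * (U * V)" by (simp add: distrib_left)
    then have "(a + b) * (U * V) = 0" unfolding VA UB by (simp add: distrib_right mult.assoc UV)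
    then have "(a + b) * (U * V) * (V' * U') = 0" by simp
    then show ?thesis by (simp add: mult.assoc canc inv)
  qed
  \<comment> \<open>This uses the pair \<open>(1, 2)\<close>; the mirrored statement for
    \<open>b\<close> uses \<open>(2, 1)\<close>.\<close>
  have aV: "V * a = a * V"
  proof (rule conjugation_defect_commutes[OF UV UA VB VA UB ab])
    show "U * (V * V) * (A + 2 *\<^sub>R B) = (A + 2 *\<^sub>R B) * (U * (V * V))"
      using comm[of 1 2] by (simp add: U_def V_def two)
    show "V * U * (U' * V') = 1" by (simp add: mult.assoc canc inv)
  qed
  have bU: "U * b = b * U"
  proof (rule conjugation_defect_commutes[OF UV[symmetric] VB UA UB VA])
    show "b + a = 0" using ab by (simp add: add.commute)
    have "U * U * V = V * (U * U)" by (metis UV mult.assoc)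
    then show "V * (U * U) * (B + 2 *\<^sub>R A) = (B + 2 *\<^sub>R A) * (V * (U * U))"
      using comm[of 2 1] by (simp add: U_def V_def two add.commute)
    show "U * V * (V' * U') = 1" by (simp add: mult.assoc canc inv)
  qed
  obtain X where X: "exp X = U" "\<And>W. W * U = U * W \<Longrightarrow> W * X = X * W"
    using exists_double_commutant_log[OF inv(2)] by blast
  obtain Y where Y: "exp Y = V" "\<And>W. W * V = V * W \<Longrightarrow> W * Y = Y * W"
    using exists_double_commutant_log[OF inv(4)] by blast
  have XY: "X * Y = Y * X"
  proof (rule Y(2))
    show "X * V = V * X" using X(2)[of V] UV by simp
  qed
  have AX: "A * X = X * A" by (rule X(2)) (rule UA[symmetric])
  have BY: "B * Y = Y * B" by (rule Y(2)) (rule VB[symmetric])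
  \<comment> \<open>Since \<open>Y\<close> commutes with its commutator with \<open>A\<close>,
    conjugating \<open>A\<close> by \<open>V = exp Y\<close> adds exactly that commutator, while
    \<open>a\<close> is by definition what conjugation adds.\<close>
  have dA: "Y * A - A * Y = a"
  proof -
    have "V * (V * A - A * V) = (V * A - A * V) * V"
      by (simp add: VA distrib_right) (simp add: mult.assoc[symmetric] aV)
    from double_commutant_second_commutator[OF Y(2) this]
    have "Y * (Y * A - A * Y) = (Y * A - A * Y) * Y" by simp
    from exp_mult_right_commutator[OF refl this]
    have "(Y * A - A * Y - a) * V = 0" by (simp add: Y(1) VA algebra_simps)
    then have "(Y * A - A * Y - a) * V * V' = 0" by simp
    then show ?thesis by (simp add: mult.assoc inv)
  qed
  have dB: "X * B - B * X = b"
  proof -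
    have "U * (U * B - B * U) = (U * B - B * U) * U"
      by (simp add: UB distrib_right) (simp add: mult.assoc[symmetric] bU)
    from double_commutant_second_commutator[OF X(2) this]
    have "X * (X * B - B * X) = (X * B - B * X) * X" by simp
    from exp_mult_right_commutator[OF refl this]
    have "(X * B - B * X - b) * U = 0" by (simp add: X(1) UB algebra_simps)
    then have "(X * B - B * X - b) * U * U' = 0" by simp
    then show ?thesis by (simp add: mult.assoc inv)
  qed
  have cross: "X * B + Y * A = A * Y + B * X" using ab dA dB by (simp add: algebra_simps)
  define S T where "S = A - X" and "T = B - Y"
  have eS: "exp S = 1"
    using exp_add_commuting[of A "- X"] AX X(1) exp_minus_inverse[of X] by (simp add: S_def U_def)
  have eT: "exp T = 1"
    using exp_add_commuting[of B "- Y"] BY Y(1) exp_minus_inverse[of Y] by (simp add: T_def V_def)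
  \<comment> \<open>Inside the exponential, integer multiples of \<open>A\<close> and
    \<open>B\<close> may be replaced by those of \<open>X\<close> and \<open>Y\<close>, so
    \<open>k A + l B\<close> and \<open>k X + l Y\<close> have the same exponential. By
    \<open>cross\<close> they commute, so their difference has exponential 1.\<close>
  have "exp (of_int k *\<^sub>R S + of_int l *\<^sub>R T) = 1" for k l :: int
  proof -
    define r q where "r = real_of_int k" and "q = real_of_int l"
    have "exp (r *\<^sub>R X + r *\<^sub>R S) = exp (r *\<^sub>R X) * exp (r *\<^sub>R S)"
      by (rule exp_add_commuting) (simp add: S_def algebra_simps AX)
    then have eA: "exp (r *\<^sub>R A) = exp (r *\<^sub>R X)"
      using exp_int_scaleR_eq_1[OF eS, of k] by (simp add: S_def r_def algebra_simps)
    have "exp (q *\<^sub>R Y + q *\<^sub>R T) = exp (q *\<^sub>R Y) * exp (q *\<^sub>R T)"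
      by (rule exp_add_commuting) (simp add: T_def algebra_simps BY)
    then have eB: "exp (q *\<^sub>R B) = exp (q *\<^sub>R Y)"
      using exp_int_scaleR_eq_1[OF eT, of l] by (simp add: T_def q_def algebra_simps)
    have eq: "exp (r *\<^sub>R A + q *\<^sub>R B) = exp (r *\<^sub>R X + q *\<^sub>R Y)"
      using H[of k l] exp_add_commuting[of "r *\<^sub>R X" "q *\<^sub>R Y"] XY
      by (simp add: eA eB flip: r_def q_def)
    have "(r * q) *\<^sub>R (X * B + Y * A) = (r * q) *\<^sub>R (A * Y + B * X)" by (simp only: cross)
    then have "(r *\<^sub>R A + q *\<^sub>R B) * - (r *\<^sub>R X + q *\<^sub>R Y) = - (r *\<^sub>R X + q *\<^sub>R Y) * (r *\<^sub>R A + q *\<^sub>R B)"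
      by (simp add: algebra_simps AX BY)
    from exp_add_commuting[OF this]
    have "exp ((r *\<^sub>R A + q *\<^sub>R B) + - (r *\<^sub>R X + q *\<^sub>R Y)) = 1"
      unfolding eq by (simp only: exp_minus_inverse)
    moreover have "(r *\<^sub>R A + q *\<^sub>R B) + - (r *\<^sub>R X + q *\<^sub>R Y) = r *\<^sub>R S + q *\<^sub>R T"
      by (simp add: S_def T_def algebra_simps)
    ultimately show ?thesis by (simp add: r_def q_def)
  qed
  moreover have "of_int k *\<^sub>R Z = cs (of_int k) * Z" for k :: int and Z :: "'n cmat"
    by (metis cs_of_real of_real_of_int_eq scaleR_conv_of_real)
  ultimately have ST: "S * T = T * S"
    by (intro exp_lattice_eq_1_commute) metis
  have SX: "S * X = X * S" by (simp add: S_def algebra_simps AX)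
  have TY: "T * Y = Y * T" by (simp add: T_def algebra_simps BY)
  define c where "c = S * Y - Y * S"
  have c2: "c = X * T - T * X"
    using cross XY by (simp add: c_def S_def T_def algebra_simps)
  \<comment> \<open>As the commutator of \<open>X\<close> and \<open>T\<close>, \<open>c\<close>
    commutes with \<open>S\<close> because both do. As the commutator of \<open>S\<close> and
    \<open>Y\<close>, it is what conjugation by \<open>exp S = 1\<close> adds to \<open>Y\<close>,
    so it is 0.\<close>
  have "S * c = c * S"
    unfolding c2 left_diff_distrib right_diff_distrib by (metis ST SX mult.assoc)
  from exp_mult_right_commutator[OF c_def[symmetric] this] have "c = 0" by (simp add: eS)
  then have "S * Y = Y * S" "X * T = T * X" using c2 by (simp_all add: c_def)
  then have "(S + X) * (T + Y) = (T + Y) * (S + X)" using ST XY by (simp add: algebra_simps)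
  then show ?thesis by (simp add: S_def T_def)
qed

theorem theorem1:
  fixes A B :: "complex^'n^'n"
  assumes "\<forall>k l :: int.
    matrix_exp (of_int k *\<^sub>R A + of_int l *\<^sub>R B)
      = matrix_exp (of_int k *\<^sub>R A) ** matrix_exp (of_int l *\<^sub>R B)"
  shows "A ** B = B ** A"
proof -
  have "exp (of_int k *\<^sub>R cmat_of A + of_int l *\<^sub>R cmat_of B)
      = exp (of_int k *\<^sub>R cmat_of A) * exp (of_int l *\<^sub>R cmat_of B)" for k l :: int
    using assms
    by (subst mat_of_inject[symmetric])
      (simp add: mat_of_exp times_cmat.rep_eq plus_cmat.rep_eq scaleR_cmat.rep_eq cmat_of_inverse)
  then have "cmat_of A * cmat_of B = cmat_of B * cmat_of A" by (rule exp_commute_of_lattice)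
  then show ?thesis by (simp add: times_cmat.abs_eq cmat_of_inject)
qed

end
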